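(* Let $\psi$ be an admissible wavelet (with respect to $\boldsymbol\alpha,\lambda$), and let $W_\psi^{\boldsymbol\alpha,\lambda}f$ and $W_\psi^{\boldsymbol\alpha,\lambda}g$ be the MFrWTs of $f,g\in L^2(\mathbb{R}^N)$ with respect to $\psi$. Then $$\int_{\mathbb{R}^N_0}\int_{\mathbb{R}^N}(W_\psi^{\boldsymbol\alpha,\lambda}f)(\boldsymbol a,\boldsymbol b)\,\overline{(W_\psi^{\boldsymbol\alpha,\lambda}g)(\boldsymbol a,\boldsymbol b)}\,\frac{d\boldsymbol a\,d\boldsymbol b}{|\boldsymbol a|_m^2}=C_{\boldsymbol\alpha,\lambda}\,\langle f,g\rangle_{L^2(\mathbb{R}^N)},$$ where $$C_{\boldsymbol\alpha,\lambda}=(2\pi)^N\int_{\mathbb{R}^N_0}|(\mathfrak F_{\boldsymbol\alpha,\lambda}\psi)(\boldsymbol u)|^2\frac{d\boldsymbol u}{|\boldsymbol u|_m}.$$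
   Context: $N\ge1$ is an integer, $\lambda\in\mathbb{R}\setminus\{0\}$, $\boldsymbol\alpha=(\alpha_1,\dots,\alpha_N)$ with $\alpha_k\in(-\pi,\pi)\setminus\{0\}$. For $\boldsymbol x\in\mathbb{R}^N$, $|\boldsymbol x|_m=|x_1x_2\cdots x_N|$ and $\mathbb{R}^N_0=\{\boldsymbol x\in\mathbb{R}^N:|\boldsymbol x|_m\ne0\}$. Products and quotients of vectors are componentwise; $\langle f,g\rangle_{L^2(\mathbb{R}^N)}=\int f\overline g$. Put $a(\alpha_k)=\tfrac12\cot\alpha_k$, $c(\alpha_k)=\sqrt{1-i\cot\alpha_k}$, $c(\boldsymbol\alpha_\lambda)=c(\alpha_1)\cdots c(\alpha_N)$, $e_{\boldsymbol\alpha,\pm\lambda^2}(\boldsymbol x)=e^{\pm i\lambda^2\sum_{k=1}^N a(\alpha_k)x_k^2}$. The multidimensional fractional Fourier transform (MFrFT) is $(\mathfrak F_{\boldsymbol\alpha,\lambda}f)(\boldsymbol\xi)=\int_{\mathbb{R}^N}f(\boldsymbol x)K_{\boldsymbol\alpha,\lambda}(\boldsymbol x,\boldsymbol\xi)\,d\boldsymbol x$ (extended to $L^2(\mathbb{R}^N)$ as usual), with kernel $K_{\boldsymbol\alpha,\lambda}(\boldsymbol x,\boldsymbol\xi)=\frac{c(\boldsymbol\alpha_\lambda)}{(\sqrt{2\pi})^N}e_{\boldsymbol\alpha,\lambda^2}(\boldsymbol x)e_{\boldsymbol\alpha,\lambda^2}(\boldsymbol\xi)e^{-i\lambda^2\sum_{k=1}^N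 x_k\xi_k\csc\alpha_k}$. An admissible wavelet is a non-zero $\psi\in L^2(\mathbb{R}^N)$ with $\int_{\mathbb{R}^N_0}|(\mathfrak F_{\boldsymbol\alpha,\lambda}\psi)(\boldsymbol u)|^2\frac{d\boldsymbol u}{|\boldsymbol u|_m}<\infty$. The multidimensional fractional wavelet transform (MFrWT) of $f\in L^2(\mathbb{R}^N)$ is, for $\boldsymbol a\in\mathbb{R}^N_0$, $\boldsymbol b\in\mathbb{R}^N$, $(W_\psi^{\boldsymbol\alpha,\lambda}f)(\boldsymbol a,\boldsymbol b)=\int_{\mathbb{R}^N}f(\boldsymbol t)\overline{\boldsymbol\Psi_{\boldsymbol\alpha,\lambda,\boldsymbol a,\boldsymbol b}(\boldsymbol t)}\,d\boldsymbol t$, where $\boldsymbol\Psi_{\boldsymbol\alpha,\lambda,\boldsymbol a,\boldsymbol b}(\boldsymbol t)=\overline{c(\boldsymbol\alpha_\lambda)}\,e_{\boldsymbol\alpha,\lambda^2}(\boldsymbol b)\,e_{\boldsymbol\alpha,-\lambda^2}(\boldsymbol t)\frac{1}{\sqrt{|\boldsymbol a|_m}}\tilde\psi\!\left(\frac{\boldsymbol t-\boldsymbol b}{\boldsymbol a}\right)$ and $\tilde\psi=\psi\,e_{\boldsymbol\alpha,\lambda^2}$. *)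

theory Defs
  imports "HOL-Analysis.Analysis"
begin

definition mod_prod :: "real ^ 'n \<Rightarrow> real" where
  "mod_prod x = \<bar>\<Prod>k\<in>UNIV. x $ k\<bar>"

definition R0N :: "(real ^ 'n) set" where
  "R0N = {x. mod_prod x \<noteq> 0}"

text \<open>Elements of the L^p spaces are functions, not classes modulo null sets. Measurability is with
  respect to the completed measure \<^const>\<open>lebesgue\<close>, so all Lebesgue measurable functions are
  allowed; consequently every integral below is taken over \<^const>\<open>lebesgue\<close> rather than
  \<^const>\<open>lborel\<close>.\<close>

definition L1_space :: "('a :: euclidean_space \<Rightarrow> complex) set" where
  "L1_space = {f. integrable lebesgue f}"

definition L2_space :: "('a :: euclidean_space \<Rightarrow> complex) set" where
  "L2_space = {f \<in> borel_measurable lebesgue. integrable lebesgue (\<lambda>x. (cmod (f x))\<^sup>2)}"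

definition L2_inner :: "('a :: euclidean_space \<Rightarrow> complex) \<Rightarrow> ('a \<Rightarrow> complex) \<Rightarrow> complex" where
  "L2_inner f g = (LINT x|lebesgue. f x * cnj (g x))"

text \<open>The squared distance is a nonnegative integral, so that it is infinite, rather than 0, when
  the difference is not square integrable.\<close>

definition L2_tendsto ::
    "(nat \<Rightarrow> 'a :: euclidean_space \<Rightarrow> complex) \<Rightarrow> ('a \<Rightarrow> complex) \<Rightarrow> bool" where
  "L2_tendsto h f \<longleftrightarrow>
     (\<lambda>n. \<integral>\<^sup>+ x. ennreal ((cmod (h n x - f x))\<^sup>2) \<partial>lebesgue) \<longlonglongrightarrow> 0"

definition acoef :: "real \<Rightarrow> real" where
  "acoef t = cot t / 2"

definition ccoef :: "real \<Rightarrow> complex" where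
  "ccoef t = csqrt (1 - \<i> * complex_of_real (cot t))"

definition cprod :: "real ^ 'n \<Rightarrow> complex" where
  "cprod \<alpha> = (\<Prod>k\<in>UNIV. ccoef (\<alpha> $ k))"

text \<open>The parameter \<open>\<mu>\<close> stands for \<open>lam\<^sup>2\<close> or \<open>- lam\<^sup>2\<close>, where \<open>lam\<close> is the real
  parameter lambda of the transform.\<close>

definition chirp :: "real ^ 'n \<Rightarrow> real \<Rightarrow> real ^ 'n \<Rightarrow> complex" where
  "chirp \<alpha> \<mu> x = exp (\<i> * complex_of_real (\<mu> * (\<Sum>k\<in>UNIV. acoef (\<alpha> $ k) * (x $ k)\<^sup>2)))"

definition mfrft_kernel :: "real ^ 'n \<Rightarrow> real \<Rightarrow> real ^ 'n \<Rightarrow> real ^ 'n \<Rightarrow> complex" where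
  "mfrft_kernel \<alpha> lam x \<xi> =
     cprod \<alpha> / complex_of_real (sqrt (2 * pi) ^ CARD('n))
     * chirp \<alpha> (lam\<^sup>2) x * chirp \<alpha> (lam\<^sup>2) \<xi>
     * exp (- \<i> * complex_of_real (lam\<^sup>2 * (\<Sum>k\<in>UNIV. x $ k * \<xi> $ k * (1 / sin (\<alpha> $ k)))))"

definition mfrft_integral ::
    "real ^ 'n \<Rightarrow> real \<Rightarrow> (real ^ 'n \<Rightarrow> complex) \<Rightarrow> real ^ 'n \<Rightarrow> complex" where
  "mfrft_integral \<alpha> lam f \<xi> = (LINT x|lebesgue. f x * mfrft_kernel \<alpha> lam x \<xi>)"

text \<open>Extension to L^2 by density of \<open>L1_space \<inter> L2_space\<close> and continuity; the value at \<open>f\<close> is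
  determined only up to a null set, and \<open>SOME\<close> picks a representative.\<close>

definition is_mfrft ::
    "real ^ 'n \<Rightarrow> real \<Rightarrow> (real ^ 'n \<Rightarrow> complex) \<Rightarrow> (real ^ 'n \<Rightarrow> complex) \<Rightarrow> bool" where
  "is_mfrft \<alpha> lam f F \<longleftrightarrow>
     F \<in> L2_space \<and>
     (\<forall>h. (\<forall>n. h n \<in> L1_space \<inter> L2_space) \<longrightarrow> L2_tendsto h f \<longrightarrow>
          L2_tendsto (\<lambda>n. mfrft_integral \<alpha> lam (h n)) F)"

definition mfrft ::
    "real ^ 'n \<Rightarrow> real \<Rightarrow> (real ^ 'n \<Rightarrow> complex) \<Rightarrow> real ^ 'n \<Rightarrow> complex" where
  "mfrft \<alpha> lam f = (SOME F. is_mfrft \<alpha> lam f F)"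

definition admissible_wavelet :: "real ^ 'n \<Rightarrow> real \<Rightarrow> (real ^ 'n \<Rightarrow> complex) \<Rightarrow> bool" where
  "admissible_wavelet \<alpha> lam \<psi> \<longleftrightarrow>
     \<psi> \<in> L2_space \<and> \<not> (AE x in lebesgue. \<psi> x = 0) \<and>
     (\<integral>\<^sup>+ u \<in> R0N. ennreal ((cmod (mfrft \<alpha> lam \<psi> u))\<^sup>2 / mod_prod u) \<partial>lebesgue) < \<infinity>"

definition admissibility_const :: "real ^ 'n \<Rightarrow> real \<Rightarrow> (real ^ 'n \<Rightarrow> complex) \<Rightarrow> real" where
  "admissibility_const \<alpha> lam \<psi> =
     (2 * pi) ^ CARD('n) * (LINT u:R0N|lebesgue. (cmod (mfrft \<alpha> lam \<psi> u))\<^sup>2 / mod_prod u)"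

definition daughter_wavelet ::
    "real ^ 'n \<Rightarrow> real \<Rightarrow> (real ^ 'n \<Rightarrow> complex) \<Rightarrow> real ^ 'n \<Rightarrow> real ^ 'n \<Rightarrow> real ^ 'n \<Rightarrow> complex" where
  "daughter_wavelet \<alpha> lam \<psi> a b t =
     (let \<psi>' = (\<lambda>x. \<psi> x * chirp \<alpha> (lam\<^sup>2) x) in
       cnj (cprod \<alpha>) * chirp \<alpha> (lam\<^sup>2) b * chirp \<alpha> (- (lam\<^sup>2)) t
       * complex_of_real (1 / sqrt (mod_prod a))
       * \<psi>' (\<chi> k. (t $ k - b $ k) / a $ k))"

definition mfrwt ::
    "real ^ 'n \<Rightarrow> real \<Rightarrow> (real ^ 'n \<Rightarrow> complex) \<Rightarrow> (real ^ 'n \<Rightarrow> complex)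
      \<Rightarrow> real ^ 'n \<Rightarrow> real ^ 'n \<Rightarrow> complex" where
  "mfrwt \<alpha> lam \<psi> f a b = (LINT t|lebesgue. f t * cnj (daughter_wavelet \<alpha> lam \<psi> a b t))"

end

theory Submission
  imports Defs "HOL-Probability.Characteristic_Functions"
begin

text \<open>
  Multiplication by the chirp and rescaling of the frequency by \<open>lam\<^sup>2 / sin (\<alpha> $ k)\<close> turn the fractional
  Fourier transform into the ordinary one, and multiplication by the chirp turns the fractional
  wavelet transform into the ordinary wavelet transform with one dilation per coordinate. Chirps have
  modulus 1, so they change neither norms nor inner products, and the theorem reduces to the
  orthogonality relation of the ordinary wavelet transform on a Euclidean space. The constants agree
  because the measure \<open>du / coord_prod u\<close> is invariant under coordinatewise dilations
  (\<open>nn_integral_dilation_invariant\<close>).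

  For the ordinary transform, write \<open>F\<close> and \<open>\<Phi>\<close> for the Fourier transforms of the signal and of the
  wavelet. By Parseval, the wavelet transform at a fixed scale \<open>a\<close> is, as a function of the translation
  \<open>b\<close>, the Fourier transform of \<open>F \<eta> * cnj (\<Phi> (a \<eta>))\<close> (\<open>cwt_eq_fourier\<close>). This product is
  integrable for every \<open>a\<close>, but square integrable only for almost every \<open>a\<close>; that it is so is read off
  from Tonelli's theorem, as admissibility makes \<open>\<integral> \<integral> |F \<eta>|\<^sup>2 |\<Phi> (a \<eta>)|\<^sup>2 / |a| da d\<eta>\<close> finite: for almost
  every \<open>\<eta>\<close> the substitution \<open>u = a \<eta>\<close> makes the inner integral independent of \<open>\<eta>\<close>. Plancherel in \<open>b\<close>
  followed by this computation shows that, after division by the right power of \<open>|a|\<close>, the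
  wavelet transform multiplies squared norms by a constant (\<open>cwt_density_isometry\<close>); integrability
  on the product space is part of this, and the statement for two signals follows by polarization
  (\<open>L2_polarization\<close>).

  The Plancherel theorem is proved by Gaussian regularization. For \<open>h\<close> in the intersection of \<open>L\<^sup>1\<close> and
  \<open>L\<^sup>2\<close> the integral of \<open>|fourier h|\<^sup>2\<close> against \<open>exp (- |t \<eta>|\<^sup>2 / 2)\<close> is a Gaussian average of
  the autocorrelation of \<open>h\<close> near 0, and the limit \<open>t \<rightarrow> 0\<close> is governed on one side by
  monotone convergence and on the other by continuity of translation in \<open>L\<^sup>2\<close>. The extension to
  \<open>L\<^sup>2\<close> rests on completeness and on the density of continuous functions with bounded support; it
  is also what shows that the \<open>SOME\<close> in the definition of \<^const>\<open>mfrft\<close> picks an actual transform,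
  unique up to null sets (\<open>is_mfrft_fourier\<close>, \<open>is_mfrft_AE_unique\<close>).
\<close>

section \<open>The space of square integrable functions\<close>

lemma borel_measurable_cnj [measurable]: "cnj \<in> borel_measurable borel"
  by (intro borel_measurable_continuous_onI continuous_intros)

definition L2_norm :: "('a :: euclidean_space \<Rightarrow> complex) \<Rightarrow> real" where
  "L2_norm f = sqrt (LINT x|lebesgue. (cmod (f x))\<^sup>2)"

lemma L2_spaceD:
  assumes "f \<in> L2_space"
  shows "f \<in> borel_measurable lebesgue" "integrable lebesgue (\<lambda>x. (cmod (f x))\<^sup>2)"
  using assms by (auto simp: L2_space_def)

lemma L2_norm_nonneg [simp]: "L2_norm f \<ge> 0"
  by (simp add: L2_norm_def)

lemma L2_norm_power2: "(L2_norm f)\<^sup>2 = (LINT x|lebesgue. (cmod (f x))\<^sup>2)"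
  by (simp add: L2_norm_def)

lemma nn_integral_L2_norm:
  assumes "f \<in> L2_space"
  shows "(\<integral>\<^sup>+x. ennreal ((cmod (f x))\<^sup>2) \<partial>lebesgue) = ennreal ((L2_norm f)\<^sup>2)"
  unfolding L2_norm_power2 using L2_spaceD[OF assms] by (intro nn_integral_eq_integral) auto

lemma L2_space_iff:
  "f \<in> L2_space \<longleftrightarrow> f \<in> borel_measurable lebesgue \<and>
     (\<integral>\<^sup>+x. ennreal ((cmod (f x))\<^sup>2) \<partial>lebesgue) < \<infinity>"
  by (auto simp: L2_space_def integrable_iff_bounded)

text \<open>Norm identities are obtained from nonnegative integrals, so that membership in \<open>L\<^sup>2\<close> and the value of
  the norm come from one computation.\<close>

lemma L2_norm_eqI:
  assumes "f \<in> borel_measurable lebesgue"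
    and "(\<integral>\<^sup>+x. ennreal ((cmod (f x))\<^sup>2) \<partial>lebesgue) = ennreal c" "c \<ge> 0"
  shows "f \<in> L2_space" "(L2_norm f)\<^sup>2 = c"
proof -
  show "f \<in> L2_space" using assms by (auto simp: L2_space_iff)
  from nn_integral_L2_norm[OF this] assms show "(L2_norm f)\<^sup>2 = c" by simp
qed

lemma L2_spaceI:
  fixes f :: "'a :: euclidean_space \<Rightarrow> complex"
  assumes "f \<in> borel_measurable lebesgue" "integrable lebesgue w" "\<And>x. (cmod (f x))\<^sup>2 \<le> w x"
  shows "f \<in> L2_space"
proof -
  have "integrable lebesgue (\<lambda>x. (cmod (f x))\<^sup>2)"
  proof (rule Bochner_Integration.integrable_bound[OF assms(2)])
    show "(\<lambda>x. (cmod (f x))\<^sup>2) \<in> borel_measurable lebesgue"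
      using assms(1) by measurable
    show "AE x in lebesgue. norm ((cmod (f x))\<^sup>2) \<le> norm (w x)"
      by (intro AE_I2) (simp, smt (verit) assms(3))
  qed
  then show ?thesis using assms(1) by (simp add: L2_space_def)
qed

lemma L2_space_cmod_le:
  assumes "f \<in> borel_measurable lebesgue" "g \<in> L2_space"
    and "\<And>x. cmod (f x) \<le> C * cmod (g x)"
  shows "f \<in> L2_space"
proof -
  have "(cmod (f x))\<^sup>2 \<le> C\<^sup>2 * (cmod (g x))\<^sup>2" for x
    using power_mono[OF assms(3)[of x], of 2] by (simp add: power_mult_distrib)
  then show ?thesis
    using integrable_mult_right[OF L2_spaceD(2)[OF assms(2)]] by (intro L2_spaceI[OF assms(1)])
qed

lemma cmod_add_power2_le: "(cmod (x + y))\<^sup>2 \<le> 2 * (cmod x)\<^sup>2 + 2 * (cmod y)\<^sup>2"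
proof -
  have "(cmod (x + y))\<^sup>2 \<le> (cmod x + cmod y)\<^sup>2"
    by (intro power_mono norm_triangle_ineq) auto
  also have "\<dots> \<le> 2 * (cmod x)\<^sup>2 + 2 * (cmod y)\<^sup>2"
    using sum_squares_bound[of "cmod x" "cmod y"] by (simp add: power2_sum)
  finally show ?thesis .
qed

lemma L2_space_add:
  assumes f: "f \<in> L2_space" and g: "g \<in> L2_space"
  shows "(\<lambda>x. f x + g x) \<in> L2_space"
proof -
  have "integrable lebesgue (\<lambda>x. 2 * (cmod (f x))\<^sup>2 + 2 * (cmod (g x))\<^sup>2)"
    using L2_spaceD(2)[OF f] L2_spaceD(2)[OF g] by simp
  then show ?thesis
    by (rule L2_spaceI[rotated])
      (rule cmod_add_power2_le, intro borel_measurable_add L2_spaceD(1)[OF f] L2_spaceD(1)[OF g])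
qed

lemma L2_space_scale:
  assumes "f \<in> L2_space"
  shows "(\<lambda>x. c * f x) \<in> L2_space"
proof (rule L2_space_cmod_le[OF _ assms])
  show "(\<lambda>x. c * f x) \<in> borel_measurable lebesgue"
    by (intro borel_measurable_times borel_measurable_const L2_spaceD(1) assms)
  show "cmod (c * f x) \<le> cmod c * cmod (f x)" for x by (simp add: norm_mult)
qed

lemma L2_space_diff:
  assumes f: "f \<in> L2_space" and g: "g \<in> L2_space"
  shows "(\<lambda>x. f x - g x) \<in> L2_space"
  using L2_space_add[OF f L2_space_scale[OF g, of "-1"]] by simp

lemma L2_mult_integrable:
  assumes f: "f \<in> L2_space" and g: "g \<in> L2_space"
  shows "integrable lebesgue (\<lambda>x. f x * cnj (g x))"
proof -
  note [measurable] = L2_spaceD(1)[OF f] L2_spaceD(1)[OF g]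
  show ?thesis
  proof (rule Bochner_Integration.integrable_bound)
    show "integrable lebesgue (\<lambda>x. (cmod (f x))\<^sup>2 + (cmod (g x))\<^sup>2)"
      by (intro Bochner_Integration.integrable_add L2_spaceD(2) f g)
    show "(\<lambda>x. f x * cnj (g x)) \<in> borel_measurable lebesgue"
      by measurable
    have "norm (f x * cnj (g x)) \<le> norm ((cmod (f x))\<^sup>2 + (cmod (g x))\<^sup>2)" for x
    proof -
      have "cmod (f x) * cmod (g x) \<le> (cmod (f x))\<^sup>2 + (cmod (g x))\<^sup>2"
        using sum_squares_bound[of "cmod (f x)" "cmod (g x)"]
          mult_nonneg_nonneg[OF norm_ge_zero[of "f x"] norm_ge_zero[of "g x"]] by linarith
      then show ?thesis by (simp add: norm_mult)
    qed
    then show "AE x in lebesgue. norm (f x * cnj (g x)) \<le> norm ((cmod (f x))\<^sup>2 + (cmod (g x))\<^sup>2)"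
      by simp
  qed
qed

lemma L2_norm_eq_inner: "L2_inner f f = complex_of_real ((L2_norm f)\<^sup>2)"
  unfolding L2_inner_def L2_norm_power2 complex_norm_square[symmetric]
  by (simp flip: of_real_power)

lemma L2_Cauchy_Schwarz:
  assumes f: "f \<in> L2_space" and g: "g \<in> L2_space"
  shows "cmod (L2_inner f g) \<le> L2_norm f * L2_norm g"
proof -
  note [measurable] = L2_spaceD(1)[OF f] L2_spaceD(1)[OF g]
  have "ennreal (cmod (L2_inner f g)) \<le> (\<integral>\<^sup>+x. ennreal (norm (f x * cnj (g x))) \<partial>lebesgue)"
    unfolding L2_inner_def by (rule integral_norm_bound_ennreal[OF L2_mult_integrable[OF f g]])
  also have "\<dots> = (\<integral>\<^sup>+x. ennreal (cmod (f x)) * ennreal (cmod (g x)) \<partial>lebesgue)"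
    by (simp add: norm_mult ennreal_mult)
  finally have "(ennreal (cmod (L2_inner f g)))\<^sup>2
      \<le> (\<integral>\<^sup>+x. ennreal (cmod (f x)) * ennreal (cmod (g x)) \<partial>lebesgue)\<^sup>2"
    by (intro power_mono) auto
  also have "\<dots> \<le> (\<integral>\<^sup>+x. (ennreal (cmod (f x)))\<^sup>2 \<partial>lebesgue) * (\<integral>\<^sup>+x. (ennreal (cmod (g x)))\<^sup>2 \<partial>lebesgue)"
    by (rule Cauchy_Schwarz_nn_integral) auto
  also have "\<dots> = ennreal ((L2_norm f * L2_norm g)\<^sup>2)"
    using nn_integral_L2_norm[OF f] nn_integral_L2_norm[OF g]
    by (simp add: ennreal_power power_mult_distrib ennreal_mult)
  finally have "(cmod (L2_inner f g))\<^sup>2 \<le> (L2_norm f * L2_norm g)\<^sup>2"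
    by (simp add: ennreal_power)
  then show ?thesis by (rule power2_le_imp_le) simp
qed

lemma L2_inner_add_left:
  assumes "f \<in> L2_space" "g \<in> L2_space" "h \<in> L2_space"
  shows "L2_inner (\<lambda>x. f x + c * g x) h = L2_inner f h + c * L2_inner g h"
  using assms L2_mult_integrable[of f h] L2_mult_integrable[of g h]
  by (simp add: L2_inner_def distrib_right mult.assoc)

lemma L2_inner_add_right:
  assumes "f \<in> L2_space" "g \<in> L2_space" "h \<in> L2_space"
  shows "L2_inner h (\<lambda>x. f x + c * g x) = L2_inner h f + cnj c * L2_inner h g"
  using assms L2_mult_integrable[of h f] L2_mult_integrable[of h g]
  by (simp add: L2_inner_def distrib_left mult.left_commute)

lemma L2_inner_diff_right:
  assumes "f \<in> L2_space" "g \<in> L2_space" "h \<in> L2_space"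
  shows "L2_inner h (\<lambda>x. f x - g x) = L2_inner h f - L2_inner h g"
  using L2_inner_add_right[OF assms, of "-1"] by simp

lemma L2_inner_commute: "L2_inner g f = cnj (L2_inner f g)"
  unfolding L2_inner_def by (subst Bochner_Integration.integral_cnj[symmetric]) (simp add: mult.commute)

lemma L2_norm_triangle:
  assumes f: "f \<in> L2_space" and g: "g \<in> L2_space"
  shows "L2_norm (\<lambda>x. f x + g x) \<le> L2_norm f + L2_norm g"
proof (rule power2_le_imp_le)
  let ?s = "\<lambda>x. f x + 1 * g x"
  have s: "?s \<in> L2_space" using L2_space_add[OF f g] by simp
  have "complex_of_real ((L2_norm ?s)\<^sup>2) = L2_inner f f + L2_inner g f + (L2_inner f g + L2_inner g g)"
    unfolding L2_norm_eq_inner[symmetric]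
    by (simp only: L2_inner_add_right[OF f g s] L2_inner_add_left[OF f g f] L2_inner_add_left[OF f g g])
       simp
  then have "(L2_norm ?s)\<^sup>2 = Re (L2_inner f f + L2_inner g f + (L2_inner f g + L2_inner g g))"
    by (metis Re_complex_of_real)
  also have "\<dots> = (L2_norm f)\<^sup>2 + 2 * Re (L2_inner f g) + (L2_norm g)\<^sup>2"
    unfolding L2_norm_eq_inner L2_inner_commute[of g f] by simp
  also have "\<dots> \<le> (L2_norm f + L2_norm g)\<^sup>2"
    using order_trans[OF complex_Re_le_cmod L2_Cauchy_Schwarz[OF f g]] by (simp add: power2_sum)
  finally show "(L2_norm (\<lambda>x. f x + g x))\<^sup>2 \<le> (L2_norm f + L2_norm g)\<^sup>2" by simp
qed simp

lemma L2_norm_minus_commute: "L2_norm (\<lambda>x. f x - g x) = L2_norm (\<lambda>x. g x - f x)"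
  by (simp add: L2_norm_def norm_minus_commute)

lemma L2_norm_triangle_diff:
  assumes f: "f \<in> L2_space" and g: "g \<in> L2_space" and h: "h \<in> L2_space"
  shows "L2_norm (\<lambda>x. f x - h x) \<le> L2_norm (\<lambda>x. f x - g x) + L2_norm (\<lambda>x. g x - h x)"
  using L2_norm_triangle[OF L2_space_diff[OF f g] L2_space_diff[OF g h]] by simp

lemma L2_norm_diff_ineq:
  assumes f: "f \<in> L2_space" and g: "g \<in> L2_space"
  shows "\<bar>L2_norm f - L2_norm g\<bar> \<le> L2_norm (\<lambda>x. f x - g x)"
  using L2_norm_triangle[OF L2_space_diff[OF f g] g] L2_norm_triangle[OF L2_space_diff[OF g f] f]
    L2_norm_minus_commute[of f g] by simp

lemma L2_tendsto_iff:
  assumes "\<And>n. h n \<in> L2_space" "f \<in> L2_space"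
  shows "L2_tendsto h f \<longleftrightarrow> (\<lambda>n. L2_norm (\<lambda>x. h n x - f x)) \<longlonglongrightarrow> 0"
proof -
  have "L2_tendsto h f \<longleftrightarrow> (\<lambda>n. ennreal ((L2_norm (\<lambda>x. h n x - f x))\<^sup>2)) \<longlonglongrightarrow> ennreal 0"
    unfolding L2_tendsto_def
    by (simp only: nn_integral_L2_norm[OF L2_space_diff[OF assms]] ennreal_0)
  also have "\<dots> \<longleftrightarrow> (\<lambda>n. (L2_norm (\<lambda>x. h n x - f x))\<^sup>2) \<longlonglongrightarrow> 0"
    by (subst tendsto_ennreal_iff) auto
  also have "\<dots> \<longleftrightarrow> (\<lambda>n. L2_norm (\<lambda>x. h n x - f x)) \<longlonglongrightarrow> 0"
    using tendsto_power[of "\<lambda>n. L2_norm (\<lambda>x. h n x - f x)" 0 sequentially 2]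
      tendsto_real_sqrt[of "\<lambda>n. (L2_norm (\<lambda>x. h n x - f x))\<^sup>2" 0 sequentially]
    by auto
  finally show ?thesis .
qed

lemma L2_tendsto_norm:
  assumes "\<And>n. h n \<in> L2_space" "f \<in> L2_space" "L2_tendsto h f"
  shows "(\<lambda>n. L2_norm (h n)) \<longlonglongrightarrow> L2_norm f"
proof (rule LIM_zero_cancel, rule Lim_null_comparison)
  show "\<forall>\<^sub>F n in sequentially. norm (L2_norm (h n) - L2_norm f) \<le> L2_norm (\<lambda>x. h n x - f x)"
    using L2_norm_diff_ineq[OF assms(1,2)] by auto
qed (use L2_tendsto_iff[OF assms(1,2)] assms(3) in auto)

lemma L2_tendsto_unique:
  assumes h: "\<And>n. h n \<in> L2_space" and "F \<in> L2_space" "G \<in> L2_space"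
    and "L2_tendsto h F" "L2_tendsto h G"
  shows "AE x in lebesgue. F x = G x"
proof -
  have "L2_norm (\<lambda>x. F x - G x) \<le> 0"
  proof (rule LIMSEQ_le_const)
    show "(\<lambda>n. L2_norm (\<lambda>x. h n x - F x) + L2_norm (\<lambda>x. h n x - G x)) \<longlonglongrightarrow> 0"
      using tendsto_add[of "\<lambda>n. L2_norm (\<lambda>x. h n x - F x)" 0 _ "\<lambda>n. L2_norm (\<lambda>x. h n x - G x)" 0]
        L2_tendsto_iff[OF h] assms by simp
    show "\<exists>N. \<forall>n\<ge>N. L2_norm (\<lambda>x. F x - G x) \<le> L2_norm (\<lambda>x. h n x - F x) + L2_norm (\<lambda>x. h n x - G x)"
      using L2_norm_triangle_diff[OF assms(2) h assms(3)] L2_norm_minus_commute[of F] by auto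
  qed
  then have "L2_norm (\<lambda>x. F x - G x) = 0" using L2_norm_nonneg by (simp add: antisym)
  then have "(LINT x|lebesgue. (cmod (F x - G x))\<^sup>2) = 0"
    using L2_norm_power2[of "\<lambda>x. F x - G x"] by simp
  then have "AE x in lebesgue. (cmod (F x - G x))\<^sup>2 = 0"
    using L2_spaceD(2)[OF L2_space_diff[OF assms(2,3)]]
    by (subst (asm) integral_nonneg_eq_0_iff_AE) auto
  then show ?thesis by eventually_elim simp
qed

lemma L2_tendsto_add:
  assumes "\<And>n. h n \<in> L2_space" "f \<in> L2_space" "L2_tendsto h f"
    and "\<And>n. k n \<in> L2_space" "g \<in> L2_space" "L2_tendsto k g"
  shows "L2_tendsto (\<lambda>n x. h n x + k n x) (\<lambda>x. f x + g x)"
proof -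
  have "(\<lambda>n. L2_norm (\<lambda>x. h n x + k n x - (f x + g x))) \<longlonglongrightarrow> 0"
  proof (rule Lim_null_comparison)
    show "\<forall>\<^sub>F n in sequentially. norm (L2_norm (\<lambda>x. h n x + k n x - (f x + g x)))
        \<le> L2_norm (\<lambda>x. h n x - f x) + L2_norm (\<lambda>x. k n x - g x)"
      using L2_norm_triangle[OF L2_space_diff[OF assms(1,2)] L2_space_diff[OF assms(4,5)]]
      by (intro always_eventually) (simp add: algebra_simps)
    show "(\<lambda>n. L2_norm (\<lambda>x. h n x - f x) + L2_norm (\<lambda>x. k n x - g x)) \<longlonglongrightarrow> 0"
      using tendsto_add[of "\<lambda>n. L2_norm (\<lambda>x. h n x - f x)" 0 _ "\<lambda>n. L2_norm (\<lambda>x. k n x - g x)" 0]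
        L2_tendsto_iff[OF assms(1,2)] L2_tendsto_iff[OF assms(4,5)] assms by simp
  qed
  then show ?thesis
    using assms by (subst L2_tendsto_iff) (auto intro: L2_space_add)
qed

text \<open>The expansion of \<open>\<parallel>u + c v\<parallel>\<^sup>2\<close> contains \<open>2 Re (cnj c * L2_inner u v)\<close>; the choices \<open>c = 1\<close> and
  \<open>c = \<i>\<close> recover the inner product. It is used both for Parseval's formula and for the wavelet
  transform, which maps into functions on a different space.\<close>

lemma L2_polarization:
  assumes f: "f \<in> L2_space" and g: "g \<in> L2_space" and F: "F \<in> L2_space" and G: "G \<in> L2_space"
    and nf: "(L2_norm F)\<^sup>2 = \<kappa> * (L2_norm f)\<^sup>2" and ng: "(L2_norm G)\<^sup>2 = \<kappa> * (L2_norm g)\<^sup>2"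
    and nfg: "\<And>c. (L2_norm (\<lambda>x. F x + c * G x))\<^sup>2 = \<kappa> * (L2_norm (\<lambda>x. f x + c * g x))\<^sup>2"
  shows "L2_inner F G = complex_of_real \<kappa> * L2_inner f g"
proof -
  have expand: "(L2_norm (\<lambda>x. u x + c * v x))\<^sup>2
      = (L2_norm u)\<^sup>2 + 2 * Re (cnj c * L2_inner u v) + (cmod c)\<^sup>2 * (L2_norm v)\<^sup>2"
    if u: "u \<in> L2_space" and v: "v \<in> L2_space" for u v :: "'c::euclidean_space \<Rightarrow> complex" and c
  proof -
    let ?s = "\<lambda>x. u x + c * v x"
    have s: "?s \<in> L2_space" using L2_space_add[OF u L2_space_scale[OF v]] by simp
    have "complex_of_real ((L2_norm ?s)\<^sup>2)
        = L2_inner u u + c * L2_inner v u + cnj c * (L2_inner u v + c * L2_inner v v)"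
      unfolding L2_norm_eq_inner[symmetric]
      by (simp only: L2_inner_add_right[OF u v s] L2_inner_add_left[OF u v u] L2_inner_add_left[OF u v v])
    then have "(L2_norm ?s)\<^sup>2
        = Re (L2_inner u u + c * L2_inner v u + cnj c * (L2_inner u v + c * L2_inner v v))"
      by (metis Re_complex_of_real)
    then show ?thesis
      unfolding L2_norm_eq_inner L2_inner_commute[of v u] cmod_power2
      by (simp add: power2_eq_square algebra_simps)
  qed
  have "Re (cnj c * L2_inner F G) = \<kappa> * Re (cnj c * L2_inner f g)" for c
    using nfg[of c] unfolding expand[OF F G] expand[OF f g] nf ng by (simp add: algebra_simps)
  from this[of 1] this[of \<i>] show ?thesis by (simp add: complex_eq_iff)
qed

section \<open>Completeness, density and Borel representatives in L2\<close>

lemma measurable_lborel_imp_lebesgue: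
  "f \<in> borel_measurable borel \<Longrightarrow> f \<in> borel_measurable lebesgue"
  by (rule measurable_completion) simp

text \<open>The usual proof by a rapidly converging subsequence. To avoid Minkowski's inequality for series, almost
  everywhere convergence is derived from the finiteness of \<open>\<Sum>k. 2 ^ k * (d k x)\<^sup>2\<close>, where \<open>d k\<close> is the
  modulus of the \<open>k\<close>-th increment: it dominates \<open>\<Sum>k. d k x\<close> up to a geometric series. Fatou's lemma then
  turns the pointwise limit into a limit in norm.\<close>

lemma L2_complete:
  fixes h :: "nat \<Rightarrow> 'a :: euclidean_space \<Rightarrow> complex"
  assumes h: "\<And>n. h n \<in> L2_space"
    and Cauchy: "\<And>e. e > 0 \<Longrightarrow> \<exists>N. \<forall>m\<ge>N. \<forall>n\<ge>N. L2_norm (\<lambda>x. h m x - h n x) < e"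
  obtains F where "F \<in> L2_space" "L2_tendsto h F"
proof -
  note [measurable] = L2_spaceD(1)[OF h]
  have "\<exists>N. \<forall>m\<ge>N. \<forall>n\<ge>N. L2_norm (\<lambda>x. h m x - h n x) < (1/2) ^ k" for k :: nat
    by (rule Cauchy) simp
  then obtain N where N: "\<And>k m n. m \<ge> N k \<Longrightarrow> n \<ge> N k \<Longrightarrow> L2_norm (\<lambda>x. h m x - h n x) < (1/2) ^ k"
    by metis
  define r where "r k = Max (N ` {..k})" for k
  have r_ge: "r k \<ge> N j" if "j \<le> k" for j k
    unfolding r_def using that by (intro Max_ge) auto
  define d where "d k x = cmod (h (r (Suc k)) x - h (r k) x)" for k x
  have d_meas [measurable]: "d k \<in> borel_measurable lebesgue" for k
    unfolding d_def by measurable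
  have d_norm: "(\<integral>\<^sup>+x. ennreal ((d k x)\<^sup>2) \<partial>lebesgue) \<le> ennreal ((1/4) ^ k)" for k
  proof -
    have "L2_norm (\<lambda>x. h (r (Suc k)) x - h (r k) x) \<le> (1/2) ^ k"
      using N[of k "r (Suc k)" "r k"] r_ge by (simp add: less_imp_le)
    then have "(L2_norm (\<lambda>x. h (r (Suc k)) x - h (r k) x))\<^sup>2 \<le> ((1/2) ^ k)\<^sup>2"
      by (intro power_mono) auto
    also have "((1/2::real) ^ k)\<^sup>2 = (1/4) ^ k"
      by (simp add: power_divide power2_eq_square flip: power_mult_distrib)
    finally show ?thesis
      unfolding d_def nn_integral_L2_norm[OF L2_space_diff[OF h h]] by (rule ennreal_leI)
  qed
  have "(\<integral>\<^sup>+x. (\<Sum>k. ennreal (2 ^ k * (d k x)\<^sup>2)) \<partial>lebesgue)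
      = (\<Sum>k. \<integral>\<^sup>+x. ennreal (2 ^ k * (d k x)\<^sup>2) \<partial>lebesgue)"
    by (rule nn_integral_suminf) measurable
  also have "\<dots> = (\<Sum>k. ennreal (2 ^ k) * (\<integral>\<^sup>+x. ennreal ((d k x)\<^sup>2) \<partial>lebesgue))"
    by (subst nn_integral_cmult[symmetric]) (measurable, simp add: ennreal_mult)
  also have "\<dots> \<le> (\<Sum>k. ennreal (2 ^ k) * ennreal ((1/4) ^ k))"
    by (intro suminf_le mult_left_mono d_norm) auto
  also have "\<dots> = (\<Sum>k. ennreal ((1/2) ^ k))"
    by (simp flip: ennreal_mult power_mult_distrib)
  also have "\<dots> < \<infinity>"
    by (simp add: suminf_ennreal2 summable_geometric)
  finally have "AE x in lebesgue. (\<Sum>k. ennreal (2 ^ k * (d k x)\<^sup>2)) \<noteq> \<infinity>"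
    by (intro nn_integral_PInf_AE) auto
  then have conv: "AE x in lebesgue. convergent (\<lambda>k. h (r k) x)"
  proof eventually_elim
    case (elim x)
    then have "summable (\<lambda>k. 2 ^ k * (d k x)\<^sup>2)"
      by (intro summable_suminf_not_top) auto
    then have s: "summable (\<lambda>k. (1/2) ^ k + 2 ^ k * (d k x)\<^sup>2)"
      by (intro summable_add summable_geometric) auto
    \<comment> \<open>This is \<open>2 \<surd>(p q) \<le> p + q\<close> for \<open>p = (1/2) ^ k\<close> and \<open>q = 2 ^ k * (d k x)\<^sup>2\<close>.\<close>
    have "d k x \<le> (1/2) ^ k + 2 ^ k * (d k x)\<^sup>2" for k
    proof -
      have "0 \<le> (1/2) ^ k * (2 ^ k * d k x - 1)\<^sup>2" by simp
      also have "\<dots> = (2 ^ k * (1/2) ^ k) * (2 ^ k * (d k x)\<^sup>2) - 2 * (2 ^ k * (1/2) ^ k) * d k x + (1/2) ^ k"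
        by (simp add: power2_eq_square algebra_simps)
      also have "(2::real) ^ k * (1/2) ^ k = 1" by (simp flip: power_mult_distrib)
      finally have "2 * d k x \<le> (1/2) ^ k + 2 ^ k * (d k x)\<^sup>2" by simp
      moreover have "d k x \<ge> 0" by (simp add: d_def)
      ultimately show ?thesis by linarith
    qed
    then have "summable (\<lambda>k. d k x)"
      by (intro summable_comparison_test'[OF s]) (simp add: d_def)
    then have "summable (\<lambda>k. h (r (Suc k)) x - h (r k) x)"
      unfolding d_def by (rule summable_norm_cancel)
    then have "convergent (\<lambda>n. \<Sum>k<n. h (r (Suc k)) x - h (r k) x)"
      by (simp add: summable_iff_convergent)
    then have "convergent (\<lambda>n. h (r n) x - h (r 0) x)"
      by (simp add: sum_lessThan_telescope[of "\<lambda>k. h (r k) x"])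
    from convergent_add[OF this convergent_const[of "h (r 0) x"]] show ?case by simp
  qed
  define F where "F x = lim (\<lambda>k. h (r k) x)" for x
  have F_meas [measurable]: "F \<in> borel_measurable lebesgue"
    unfolding F_def by measurable
  have lim: "AE x in lebesgue. (\<lambda>k. h (r k) x) \<longlonglongrightarrow> F x"
    using conv by eventually_elim (simp add: F_def convergent_LIMSEQ_iff)
  have est: "(\<integral>\<^sup>+x. ennreal ((cmod (h n x - F x))\<^sup>2) \<partial>lebesgue) \<le> ennreal (((1/2) ^ j)\<^sup>2)"
    if n: "n \<ge> N j" for n j
  proof -
    have "(\<integral>\<^sup>+x. ennreal ((cmod (h n x - F x))\<^sup>2) \<partial>lebesgue)
        = (\<integral>\<^sup>+x. liminf (\<lambda>k. ennreal ((cmod (h n x - h (r k) x))\<^sup>2)) \<partial>lebesgue)"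
      using lim
    proof (intro nn_integral_cong_AE, eventually_elim)
      case (elim x)
      have "(\<lambda>k. ennreal ((cmod (h n x - h (r k) x))\<^sup>2)) \<longlonglongrightarrow> ennreal ((cmod (h n x - F x))\<^sup>2)"
        by (intro tendsto_ennrealI tendsto_intros elim)
      then show ?case by (intro lim_imp_Liminf[symmetric]) auto
    qed
    also have "\<dots> \<le> liminf (\<lambda>k. \<integral>\<^sup>+x. ennreal ((cmod (h n x - h (r k) x))\<^sup>2) \<partial>lebesgue)"
      by (rule nn_integral_liminf) measurable
    also have "\<dots> \<le> limsup (\<lambda>k. \<integral>\<^sup>+x. ennreal ((cmod (h n x - h (r k) x))\<^sup>2) \<partial>lebesgue)"
      by (rule Liminf_le_Limsup) simp
    also have "\<dots> \<le> ennreal (((1/2) ^ j)\<^sup>2)"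
    proof (rule Limsup_bounded, rule eventually_sequentiallyI)
      fix k assume "j \<le> k"
      then have "L2_norm (\<lambda>x. h n x - h (r k) x) \<le> (1/2) ^ j"
        using N[OF n r_ge] by (simp add: less_imp_le)
      then show "(\<integral>\<^sup>+x. ennreal ((cmod (h n x - h (r k) x))\<^sup>2) \<partial>lebesgue) \<le> ennreal (((1/2) ^ j)\<^sup>2)"
        unfolding nn_integral_L2_norm[OF L2_space_diff[OF h h]]
        by (intro ennreal_leI power_mono) auto
    qed
    finally show ?thesis .
  qed
  have diff: "(\<lambda>x. h n x - F x) \<in> L2_space" if "n \<ge> N 0" for n
    unfolding L2_space_iff
  proof
    show "(\<integral>\<^sup>+x. ennreal ((cmod (h n x - F x))\<^sup>2) \<partial>lebesgue) < \<infinity>"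
      using est[OF that] by (rule le_less_trans) simp
  qed measurable
  have F: "F \<in> L2_space"
    using L2_space_diff[OF h diff[OF order_refl], of "N 0"] by simp
  have "(\<lambda>n. L2_norm (\<lambda>x. h n x - F x)) \<longlonglongrightarrow> 0"
  proof (rule LIMSEQ_I)
    fix e :: real assume "e > 0"
    then obtain j where j: "(1/2) ^ j < e" using real_arch_pow_inv[of e "1/2"] by auto
    have "L2_norm (\<lambda>x. h n x - F x) < e" if "n \<ge> N j" for n
    proof -
      have "(L2_norm (\<lambda>x. h n x - F x))\<^sup>2 \<le> ((1/2) ^ j)\<^sup>2"
        using est[OF that] unfolding nn_integral_L2_norm[OF L2_space_diff[OF h F]]
        by (subst (asm) ennreal_le_iff) auto
      then have "L2_norm (\<lambda>x. h n x - F x) \<le> (1/2) ^ j" by (rule power2_le_imp_le) simp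
      with j show ?thesis by simp
    qed
    then show "\<exists>no. \<forall>n\<ge>no. norm (L2_norm (\<lambda>x. h n x - F x) - 0) < e"
      by auto
  qed
  then show thesis
    by (intro that[OF F]) (simp add: L2_tendsto_iff[OF h F])
qed

definition bounded_supp_continuous :: "('a :: euclidean_space \<Rightarrow> complex) \<Rightarrow> bool" where
  "bounded_supp_continuous k \<longleftrightarrow> continuous_on UNIV k \<and>
     (\<exists>B R. \<forall>x. cmod (k x) \<le> B \<and> (norm x > R \<longrightarrow> k x = 0))"

lemma integrable_indicator_cball:
  "integrable lebesgue (\<lambda>x::'a::euclidean_space. C * indicator (cball 0 R) x :: real)"
proof -
  have "emeasure lborel (cball (0::'a) R) < \<infinity>"
    using emeasure_bounded_finite[OF bounded_cball] by auto
  then show ?thesis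
    by (intro integrable_mult_right) (auto simp: integrable_indicator_iff)
qed

lemma bounded_supp_continuous_L1_L2:
  fixes k :: "'a :: euclidean_space \<Rightarrow> complex"
  assumes "bounded_supp_continuous k"
  shows "k \<in> L1_space" "k \<in> L2_space"
proof -
  obtain B R where B: "\<And>x. cmod (k x) \<le> B" and R: "\<And>x. norm x > R \<Longrightarrow> k x = 0"
    and k: "continuous_on UNIV k"
    using assms unfolding bounded_supp_continuous_def by blast
  have meas: "k \<in> borel_measurable lebesgue"
    using k by (intro measurable_lborel_imp_lebesgue borel_measurable_continuous_onI)
  have le: "cmod (k x) \<le> B * indicator (cball 0 R) x" for x
    using B[of x] R[of x] by (auto simp: indicator_def)
  have "integrable lebesgue k"
  proof (rule Bochner_Integration.integrable_bound[OF integrable_indicator_cball meas])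
    show "AE x in lebesgue. norm (k x) \<le> norm (B * indicator (cball 0 R) x :: real)"
      by (intro AE_I2 order_trans[OF le]) simp
  qed
  then show "k \<in> L1_space" by (simp add: L1_space_def)
  have "(cmod (k x))\<^sup>2 \<le> B\<^sup>2 * indicator (cball 0 R) x" for x
    using power_mono[OF le[of x], of 2] by (auto simp: indicator_def power_mult_distrib split: if_splits)
  then show "k \<in> L2_space" by (intro L2_spaceI[OF meas integrable_indicator_cball])
qed

lemma L2_norm_tendsto_0:
  fixes h :: "nat \<Rightarrow> 'a :: euclidean_space \<Rightarrow> complex"
  assumes meas: "\<And>n. h n \<in> borel_measurable lebesgue" and w: "integrable lebesgue w"
    and le: "\<And>n x. (cmod (h n x))\<^sup>2 \<le> w x"
    and lim: "AE x in lebesgue. (\<lambda>n. h n x) \<longlonglongrightarrow> 0"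
  shows "(\<lambda>n. L2_norm (h n)) \<longlonglongrightarrow> 0"
proof -
  note [measurable] = meas
  have "(\<lambda>n. LINT x|lebesgue. (cmod (h n x))\<^sup>2) \<longlonglongrightarrow> (LINT x|(lebesgue :: 'a measure). (0::real))"
  proof (rule integral_dominated_convergence[where w = w])
    show "AE x in lebesgue. (\<lambda>n. (cmod (h n x))\<^sup>2) \<longlonglongrightarrow> 0"
      using lim
    proof eventually_elim
      case (elim x)
      from tendsto_power[OF tendsto_norm[OF elim], of 2] show ?case by simp
    qed
    show "AE x in lebesgue. norm ((cmod (h n x))\<^sup>2) \<le> w x" for n
      using le[of n] by (intro AE_I2) simp
  qed (use w in measurable)
  from tendsto_real_sqrt[OF this] show ?thesis by (simp add: L2_norm_def)
qed

text \<open>The function is first truncated in size and support. A measurable function is an almost everywhere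
  limit of continuous functions \<open>G m\<close>; these are scaled back to modulus at most \<open>B\<close> and multiplied by a
  cutoff \<open>\<phi>\<close>, which keeps them dominated without changing the limit.\<close>

lemma L2_dense_continuous:
  fixes f :: "'a :: euclidean_space \<Rightarrow> complex"
  assumes f: "f \<in> L2_space" and e: "e > 0"
  obtains k where "bounded_supp_continuous k" "L2_norm (\<lambda>x. f x - k x) < e"
proof -
  note [measurable] = L2_spaceD(1)[OF f]
  have [measurable]: "(\<lambda>x::'a. norm x) \<in> borel_measurable lebesgue"
    by (rule measurable_lborel_imp_lebesgue) simp
  define fn where "fn n x = (if cmod (f x) \<le> real n \<and> norm x \<le> real n then f x else 0)" for n x
  have fn_meas [measurable]: "fn n \<in> borel_measurable lebesgue" for n
    unfolding fn_def by measurable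
  have "(\<lambda>n. L2_norm (\<lambda>x. f x - fn n x)) \<longlonglongrightarrow> 0"
  proof (rule L2_norm_tendsto_0[OF _ L2_spaceD(2)[OF f]])
    show "(cmod (f x - fn n x))\<^sup>2 \<le> (cmod (f x))\<^sup>2" for n x by (simp add: fn_def)
    have "(\<lambda>n. f x - fn n x) \<longlonglongrightarrow> 0" for x
    proof (rule tendsto_eventually, rule eventually_sequentiallyI)
      fix n assume "nat \<lceil>max (cmod (f x)) (norm x)\<rceil> \<le> n"
      then show "f x - fn n x = 0" by (simp add: fn_def)
    qed
    then show "AE x in lebesgue. (\<lambda>n. f x - fn n x) \<longlonglongrightarrow> 0" by simp
  qed measurable
  then have "\<forall>\<^sub>F n in sequentially. L2_norm (\<lambda>x. f x - fn n x) < e/2"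
    using e by (intro order_tendstoD(2)) auto
  then obtain n where n: "L2_norm (\<lambda>x. f x - fn n x) < e/2"
    using eventually_happens by fastforce
  define g where "g = fn n"
  \<comment> \<open>One more than the truncation level, so that \<open>\<phi>\<close> equals 1 where \<open>g\<close> can be nonzero.\<close>
  define B where "B = real n + 1"
  have B: "B > 0" by (simp add: B_def)
  have g_bd: "cmod (g x) \<le> B" "cmod (g x) < B" and g_supp: "norm x > real n \<Longrightarrow> g x = 0" for x
    by (auto simp: g_def fn_def B_def)
  have g_meas [measurable]: "g \<in> borel_measurable lebesgue" by (simp add: g_def)
  have g: "g \<in> L2_space"
    by (rule L2_space_cmod_le[OF g_meas f, of 1]) (simp add: g_def fn_def)
  have "g measurable_on UNIV"
    using g_meas by (intro lebesgue_measurable_imp_measurable_on) auto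
  then obtain N G where N: "negligible N" and G: "\<And>m. continuous_on UNIV (G m)"
    and lim: "\<And>x. x \<notin> N \<Longrightarrow> (\<lambda>m. G m x) \<longlonglongrightarrow> g x"
    unfolding measurable_on_def by auto
  define \<phi> where "\<phi> x = max 0 (min 1 (B - norm x))" for x :: 'a
  define c where "c m x = complex_of_real (\<phi> x * (B / max B (cmod (G m x)))) * G m x" for m x
  have max_pos: "max B u > 0" for u using B by simp
  have c_cont: "continuous_on UNIV (c m)" for m
    unfolding c_def \<phi>_def
    using max_pos by (intro continuous_intros G) (auto simp: less_imp_neq[symmetric])
  have c_bd: "cmod (c m x) \<le> B" for m x
  proof -
    have "B * cmod (G m x) \<le> B * max B (cmod (G m x))" using B by (intro mult_left_mono) auto
    then have "B / max B (cmod (G m x)) * cmod (G m x) \<le> B"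
      using max_pos by (simp add: field_simps pos_divide_le_eq)
    moreover have "0 \<le> \<phi> x" "\<phi> x \<le> 1" by (auto simp: \<phi>_def)
    ultimately have "\<phi> x * (B / max B (cmod (G m x)) * cmod (G m x)) \<le> 1 * B"
      using B max_pos by (intro mult_mono) auto
    moreover have "cmod (c m x) = \<phi> x * (B / max B (cmod (G m x)) * cmod (G m x))"
      using \<open>0 \<le> \<phi> x\<close> B max_pos[of "cmod (G m x)"]
      unfolding c_def norm_mult norm_of_real by (simp add: abs_mult)
    ultimately show ?thesis by simp
  qed
  have c_supp: "c m x = 0" if "norm x > B" for m x
    using that by (simp add: c_def \<phi>_def)
  have c_bsc: "bounded_supp_continuous (c m)" for m
    unfolding bounded_supp_continuous_def using c_cont c_bd c_supp by blast
  note c_L2 = bounded_supp_continuous_L1_L2(2)[OF c_bsc]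
  have "(\<lambda>m. L2_norm (\<lambda>x. g x - c m x)) \<longlonglongrightarrow> 0"
  proof (rule L2_norm_tendsto_0[OF _ integrable_indicator_cball[of "(2 * B)\<^sup>2" B]])
    show "(\<lambda>x. g x - c m x) \<in> borel_measurable lebesgue" for m
      using L2_spaceD(1)[OF L2_space_diff[OF g c_L2]] .
    show "(cmod (g x - c m x))\<^sup>2 \<le> (2 * B)\<^sup>2 * indicator (cball 0 B) x" for m x
    proof (cases "norm x \<le> B")
      case True
      have "cmod (g x - c m x) \<le> 2 * B"
        using norm_triangle_ineq4[of "g x" "c m x"] g_bd(1)[of x] c_bd[of m x] by linarith
      then have "(cmod (g x - c m x))\<^sup>2 \<le> (2 * B)\<^sup>2" by (intro power_mono) auto
      with True show ?thesis by (simp add: indicator_def)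
    next
      case False
      then show ?thesis using g_supp[of x] c_supp[of x] by (simp add: B_def)
    qed
    have "(\<lambda>m. g x - c m x) \<longlonglongrightarrow> 0" if "x \<notin> N" for x
    proof -
      have "max B (cmod (g x)) = B" using g_bd[of x] by (simp add: max_def)
      then have "(\<lambda>m. c m x) \<longlonglongrightarrow> complex_of_real (\<phi> x * (B / B)) * g x"
        unfolding c_def using lim[OF that] B
        by (auto intro!: tendsto_eq_intros)
      moreover have "complex_of_real (\<phi> x * (B / B)) * g x = g x"
        using g_supp[of x] B by (cases "norm x > real n") (auto simp: \<phi>_def B_def)
      ultimately have "(\<lambda>m. c m x) \<longlonglongrightarrow> g x" by metis
      from tendsto_diff[OF tendsto_const[of "g x"] this] show ?thesis by simp
    qed
    moreover have "AE x in lebesgue. x \<notin> N"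
      using N by (auto simp: negligible_iff_null_sets intro: AE_not_in)
    ultimately show "AE x in lebesgue. (\<lambda>m. g x - c m x) \<longlonglongrightarrow> 0" by auto
  qed
  then have "\<forall>\<^sub>F m in sequentially. L2_norm (\<lambda>x. g x - c m x) < e/2"
    using e by (intro order_tendstoD(2)) auto
  then obtain m where m: "L2_norm (\<lambda>x. g x - c m x) < e/2"
    using eventually_happens by fastforce
  have "L2_norm (\<lambda>x. f x - c m x) < e"
    using L2_norm_triangle_diff[OF f g c_L2[of m]] m n by (simp add: g_def)
  with c_bsc show thesis by (rule that)
qed

corollary L2_dense_L1:
  fixes f :: "'a :: euclidean_space \<Rightarrow> complex"
  assumes f: "f \<in> L2_space"
  obtains h where "\<And>n::nat. h n \<in> L1_space \<inter> L2_space" "L2_tendsto h f"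
proof -
  have "\<exists>k. bounded_supp_continuous k \<and> L2_norm (\<lambda>x. f x - k x) < inverse (real (Suc n))" for n
    by (rule L2_dense_continuous[OF f, of "inverse (real (Suc n))"]) auto
  then obtain h where h: "\<And>n. bounded_supp_continuous (h n)"
    and le: "\<And>n. L2_norm (\<lambda>x. f x - h n x) < inverse (real (Suc n))" by metis
  note L = bounded_supp_continuous_L1_L2[OF h]
  have "(\<lambda>n. L2_norm (\<lambda>x. h n x - f x)) \<longlonglongrightarrow> 0"
  proof (rule Lim_null_comparison[OF _ LIMSEQ_inverse_real_of_nat])
    show "\<forall>\<^sub>F n in sequentially. norm (L2_norm (\<lambda>x. h n x - f x)) \<le> inverse (real (Suc n))"
      using le by (simp add: L2_norm_minus_commute[of _ f] less_imp_le)
  qed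
  then show thesis using L by (intro that[of h]) (auto simp: L2_tendsto_iff[OF L(2) f])
qed

text \<open>Fubini's theorem concerns products of Borel measures, while the elements of \<open>L\<^sup>2\<close> are only Lebesgue
  measurable; Borel representatives bridge the gap.\<close>

lemma lebesgue_ex_borel:
  fixes f :: "'a :: euclidean_space \<Rightarrow> complex"
  assumes [measurable]: "f \<in> borel_measurable lebesgue"
  obtains f' where "f' \<in> borel_measurable borel" "AE x in lebesgue. f x = f' x"
proof -
  obtain u where u: "u \<in> borel_measurable lborel" "AE x in lborel. Re (f x) = u x"
    using completion_ex_borel_measurable_real[of "\<lambda>x. Re (f x)" lborel] by auto
  obtain v where v: "v \<in> borel_measurable lborel" "AE x in lborel. Im (f x) = v x"
    using completion_ex_borel_measurable_real[of "\<lambda>x. Im (f x)" lborel] by auto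
  show thesis
  proof
    show "(\<lambda>x. Complex (u x) (v x)) \<in> borel_measurable borel"
      using u(1) v(1) by (simp add: borel_measurable_complex_iff)
    from u(2) v(2) have "AE x in lborel. f x = Complex (u x) (v x)"
      by eventually_elim (simp add: complex_eq_iff)
    then show "AE x in lebesgue. f x = Complex (u x) (v x)" by (rule AE_completion)
  qed
qed

section \<open>Coordinatewise affine changes of variables\<close>

text \<open>The multipliers are collected in a vector, so that one notion covers translations and scalar dilations
  (multiplier \<open>s *\<^sub>R One\<close>) as well as the dilations of the wavelet transform.\<close>

definition coord_scale :: "'a :: euclidean_space \<Rightarrow> 'a \<Rightarrow> 'a" where
  "coord_scale c x = (\<Sum>j\<in>Basis. ((c \<bullet> j) * (x \<bullet> j)) *\<^sub>R j)"

definition coord_prod :: "'a :: euclidean_space \<Rightarrow> real" where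
  "coord_prod c = (\<Prod>j\<in>Basis. \<bar>c \<bullet> j\<bar>)"

lemma coord_scale_inner: "j \<in> Basis \<Longrightarrow> coord_scale c x \<bullet> j = (c \<bullet> j) * (x \<bullet> j)"
  by (simp add: coord_scale_def)

context
  fixes c t :: "'a :: euclidean_space"
  assumes c: "coord_prod c \<noteq> 0"
begin

lemma coord_nz: "j \<in> Basis \<Longrightarrow> c \<bullet> j \<noteq> 0"
  using c by (auto simp: coord_prod_def)

lemma lebesgue_eq_affine:
  "lebesgue = density (distr lebesgue lebesgue (\<lambda>x. t + coord_scale c x)) (\<lambda>_. ennreal (coord_prod c))"
  using lebesgue_affine_euclidean[of "\<lambda>j. c \<bullet> j" t] coord_nz
  unfolding coord_scale_def coord_prod_def by simp

lemma measurable_affine: "(\<lambda>x. t + coord_scale c x) \<in> lebesgue \<rightarrow>\<^sub>M lebesgue"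
  using lebesgue_affine_measurable[of "\<lambda>j. c \<bullet> j" t] coord_nz
  unfolding coord_scale_def by simp

lemma measurable_compose_affine:
  "f \<in> borel_measurable lebesgue \<Longrightarrow> (\<lambda>x. f (t + coord_scale c x)) \<in> borel_measurable lebesgue"
  by (rule measurable_compose[OF measurable_affine])

lemma nn_integral_affine:
  assumes f: "f \<in> borel_measurable lebesgue"
  shows "(\<integral>\<^sup>+x. f x \<partial>lebesgue) = ennreal (coord_prod c) * (\<integral>\<^sup>+x. f (t + coord_scale c x) \<partial>lebesgue)"
proof -
  have fd: "f \<in> borel_measurable (distr lebesgue lebesgue (\<lambda>x. t + coord_scale c x))"
    using f by simp
  have "(\<integral>\<^sup>+x. f x \<partial>lebesgue)
      = (\<integral>\<^sup>+x. f x \<partial>density (distr lebesgue lebesgue (\<lambda>x. t + coord_scale c x)) (\<lambda>_. ennreal (coord_prod c)))"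
    by (subst lebesgue_eq_affine) simp
  also have "\<dots> = ennreal (coord_prod c) * (\<integral>\<^sup>+x. f x \<partial>distr lebesgue lebesgue (\<lambda>x. t + coord_scale c x))"
    using fd by (subst nn_integral_density) (auto simp: nn_integral_cmult)
  also have "\<dots> = ennreal (coord_prod c) * (\<integral>\<^sup>+x. f (t + coord_scale c x) \<partial>lebesgue)"
    by (subst nn_integral_distr[OF measurable_affine fd]) simp
  finally show ?thesis .
qed

lemma integral_affine:
  fixes f :: "'a \<Rightarrow> complex"
  assumes f: "f \<in> borel_measurable lebesgue"
  shows "(LINT x|lebesgue. f x) = complex_of_real (coord_prod c) * (LINT x|lebesgue. f (t + coord_scale c x))"
proof -
  have fd: "f \<in> borel_measurable (distr lebesgue lebesgue (\<lambda>x. t + coord_scale c x))"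
    using f by simp
  have "(LINT x|lebesgue. f x)
      = (LINT x|density (distr lebesgue lebesgue (\<lambda>x. t + coord_scale c x)) (\<lambda>_. ennreal (coord_prod c)). f x)"
    by (subst lebesgue_eq_affine) simp
  also have "\<dots> = (LINT x|distr lebesgue lebesgue (\<lambda>x. t + coord_scale c x). coord_prod c *\<^sub>R f x)"
    using fd by (intro integral_density) (auto simp: coord_prod_def prod_nonneg)
  also have "\<dots> = coord_prod c *\<^sub>R (LINT x|lebesgue. f (t + coord_scale c x))"
    by (subst integral_scaleR_right, subst integral_distr[OF measurable_affine f]) simp
  finally show ?thesis by (simp add: scaleR_conv_of_real)
qed

lemma integrable_affine:
  fixes f :: "'a \<Rightarrow> 'b :: {banach, second_countable_topology}"
  assumes f: "integrable lebesgue f"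
  shows "integrable lebesgue (\<lambda>x. f (t + coord_scale c x))"
proof -
  have fm: "f \<in> borel_measurable lebesgue" using f by (rule borel_measurable_integrable)
  have "ennreal (coord_prod c) * (\<integral>\<^sup>+x. norm (f (t + coord_scale c x)) \<partial>lebesgue) < \<infinity>"
    using f nn_integral_affine[of "\<lambda>x. ennreal (norm (f x))"] fm by (simp add: integrable_iff_bounded)
  moreover have "ennreal (coord_prod c) \<noteq> 0"
    using c by (simp add: coord_prod_def prod_nonneg less_le)
  ultimately have "(\<integral>\<^sup>+x. norm (f (t + coord_scale c x)) \<partial>lebesgue) < \<infinity>"
    by (auto simp: ennreal_mult_less_top)
  then show ?thesis
    using measurable_compose_affine[OF fm] by (simp add: integrable_iff_bounded)
qed

lemma L2_space_affine:
  assumes "f \<in> L2_space"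
  shows "(\<lambda>x. f (t + coord_scale c x)) \<in> L2_space"
  unfolding L2_space_def
  using integrable_affine[OF L2_spaceD(2)[OF assms]] measurable_compose_affine[OF L2_spaceD(1)[OF assms]]
  by simp

lemma L2_norm_affine:
  assumes f: "f \<in> L2_space"
  shows "L2_norm f = sqrt (coord_prod c) * L2_norm (\<lambda>x. f (t + coord_scale c x))"
proof -
  have meas: "(\<lambda>x. ennreal ((cmod (f x))\<^sup>2)) \<in> borel_measurable lebesgue"
    using L2_spaceD(1)[OF f] by measurable
  have "ennreal ((L2_norm f)\<^sup>2) = ennreal (coord_prod c) * ennreal ((L2_norm (\<lambda>x. f (t + coord_scale c x)))\<^sup>2)"
    using nn_integral_affine[OF meas] nn_integral_L2_norm[OF f] nn_integral_L2_norm[OF L2_space_affine[OF f]]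
    by simp
  also have "\<dots> = ennreal (coord_prod c * (L2_norm (\<lambda>x. f (t + coord_scale c x)))\<^sup>2)"
    by (subst ennreal_mult) (auto simp: coord_prod_def prod_nonneg)
  finally have "(L2_norm f)\<^sup>2 = coord_prod c * (L2_norm (\<lambda>x. f (t + coord_scale c x)))\<^sup>2"
    by (subst (asm) ennreal_inj) (auto simp: coord_prod_def prod_nonneg)
  then have "sqrt ((L2_norm f)\<^sup>2) = sqrt (coord_prod c * (L2_norm (\<lambda>x. f (t + coord_scale c x)))\<^sup>2)"
    by simp
  then show ?thesis by (simp add: real_sqrt_mult)
qed

lemma L2_tendsto_affine:
  assumes h: "\<And>n. h n \<in> L2_space" and f: "f \<in> L2_space" and "L2_tendsto h f"
  shows "L2_tendsto (\<lambda>n x. h n (t + coord_scale c x)) (\<lambda>x. f (t + coord_scale c x))"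
proof -
  have "(\<lambda>n. L2_norm (\<lambda>x. h n x - f x) / sqrt (coord_prod c)) \<longlonglongrightarrow> 0 / sqrt (coord_prod c)"
    using assms L2_tendsto_iff[OF h f] c by (intro tendsto_divide tendsto_const) auto
  also have "(\<lambda>n. L2_norm (\<lambda>x. h n x - f x) / sqrt (coord_prod c))
      = (\<lambda>n. L2_norm (\<lambda>x. h n (t + coord_scale c x) - f (t + coord_scale c x)))"
    using L2_norm_affine[OF L2_space_diff[OF h f]] c by simp
  finally show ?thesis
    by (simp add: L2_tendsto_iff[OF L2_space_affine[OF h] L2_space_affine[OF f]])
qed

end

lemma coord_scale_One: "coord_scale (s *\<^sub>R One) x = s *\<^sub>R (x :: 'a :: euclidean_space)"
  by (rule euclidean_eqI) (simp add: coord_scale_inner)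

lemma coord_prod_One: "coord_prod (s *\<^sub>R One :: 'a :: euclidean_space) = \<bar>s\<bar> ^ DIM('a)"
  by (simp add: coord_prod_def)

lemma L2_translate:
  fixes f :: "'a :: euclidean_space \<Rightarrow> complex"
  assumes "f \<in> L2_space"
  shows "(\<lambda>x. f (a + x)) \<in> L2_space" "L2_norm (\<lambda>x. f (a + x)) = L2_norm f"
  using L2_space_affine[of "1 *\<^sub>R One" f a] L2_norm_affine[of "1 *\<^sub>R One" f a] assms
  by (simp_all only: coord_scale_One coord_prod_One) simp_all

text \<open>Immediate by dominated convergence for continuous functions with bounded support, and carried over by
  density because translations are isometries.\<close>

lemma L2_translation_continuous:
  fixes h :: "'a :: euclidean_space \<Rightarrow> complex"
  assumes h: "h \<in> L2_space" and z: "z \<longlonglongrightarrow> 0"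
  shows "L2_tendsto (\<lambda>n x. h (z n + x)) h"
proof -
  note tr = L2_translate
  have "(\<lambda>n. L2_norm (\<lambda>x. h (z n + x) - h x)) \<longlonglongrightarrow> 0"
  proof (rule LIMSEQ_I)
    fix e :: real assume e: "e > 0"
    obtain k where k: "bounded_supp_continuous k" and hk: "L2_norm (\<lambda>x. h x - k x) < e / 3"
      using L2_dense_continuous[OF h, of "e / 3"] e by auto
    note kL = bounded_supp_continuous_L1_L2(2)[OF k]
    obtain B R where B: "\<And>x. cmod (k x) \<le> B" and R: "\<And>x. norm x > R \<Longrightarrow> k x = 0"
      and kc: "continuous_on UNIV k"
      using k unfolding bounded_supp_continuous_def by blast
    obtain Z where Z: "\<And>n. norm (z n) \<le> Z"
      using convergent_imp_Bseq[OF convergentI[OF z]] by (auto simp: Bseq_def)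
    have "(\<lambda>n. L2_norm (\<lambda>x. k (z n + x) - k x)) \<longlonglongrightarrow> 0"
    proof (rule L2_norm_tendsto_0[OF _ integrable_indicator_cball[of "(2 * B)\<^sup>2" "R + Z"]])
      show "(\<lambda>x. k (z n + x) - k x) \<in> borel_measurable lebesgue" for n
        by (rule L2_spaceD(1)[OF L2_space_diff[OF tr(1)[OF kL] kL]])
      show "(cmod (k (z n + x) - k x))\<^sup>2 \<le> (2 * B)\<^sup>2 * indicator (cball 0 (R + Z)) x" for n x
      proof (cases "norm x \<le> R + Z")
        case True
        have "cmod (k (z n + x) - k x) \<le> 2 * B"
          using norm_triangle_ineq4[of "k (z n + x)" "k x"] B[of x] B[of "z n + x"] by linarith
        then have "(cmod (k (z n + x) - k x))\<^sup>2 \<le> (2 * B)\<^sup>2" by (intro power_mono) auto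
        with True show ?thesis by (simp add: indicator_def)
      next
        case False
        have "norm x \<le> norm (z n + x) + norm (z n)"
          using norm_triangle_ineq4[of "z n + x" "z n"] by simp
        then have "norm (z n + x) > R" "norm x > R"
          using False Z[of n] norm_ge_zero[of "z n"] by linarith+
        then show ?thesis using R False by simp
      qed
      have "(\<lambda>n. k (z n + x) - k x) \<longlonglongrightarrow> 0" for x
      proof -
        have "isCont k (0 + x)"
          using kc by (simp add: continuous_on_eq_continuous_at)
        then have "(\<lambda>n. k (z n + x)) \<longlonglongrightarrow> k (0 + x)"
          by (rule isCont_tendsto_compose) (intro tendsto_intros z)
        from tendsto_diff[OF this tendsto_const[of "k x"]] show ?thesis by simp
      qed
      then show "AE x in lebesgue. (\<lambda>n. k (z n + x) - k x) \<longlonglongrightarrow> 0" by simp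
    qed
    then have "\<forall>\<^sub>F n in sequentially. L2_norm (\<lambda>x. k (z n + x) - k x) < e / 3"
      using e by (intro order_tendstoD(2)) auto
    then obtain N where N: "\<And>n. n \<ge> N \<Longrightarrow> L2_norm (\<lambda>x. k (z n + x) - k x) < e / 3"
      by (auto simp: eventually_sequentially)
    have "L2_norm (\<lambda>x. h (z n + x) - h x) < e" if "n \<ge> N" for n
    proof -
      have "L2_norm (\<lambda>x. h (z n + x) - h x)
          \<le> L2_norm (\<lambda>x. h (z n + x) - k (z n + x)) + L2_norm (\<lambda>x. k (z n + x) - h x)"
        by (intro L2_norm_triangle_diff tr(1) h kL)
      moreover have "L2_norm (\<lambda>x. k (z n + x) - h x)
          \<le> L2_norm (\<lambda>x. k (z n + x) - k x) + L2_norm (\<lambda>x. k x - h x)"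
        by (intro L2_norm_triangle_diff tr(1) h kL)
      moreover have "L2_norm (\<lambda>x. h (z n + x) - k (z n + x)) = L2_norm (\<lambda>x. h x - k x)"
        by (rule tr(2)[OF L2_space_diff[OF h kL]])
      ultimately show ?thesis
        using N[OF that] hk L2_norm_minus_commute[of h k] by linarith
    qed
    then show "\<exists>no. \<forall>n\<ge>no. norm (L2_norm (\<lambda>x. h (z n + x) - h x) - 0) < e" by auto
  qed
  then show ?thesis by (simp add: L2_tendsto_iff[OF tr(1)[OF h] h])
qed

section \<open>The Fourier transform of the Gaussian\<close>

text \<open>The integrand is, up to a factor, the standard normal density times a character, so this is the
  characteristic function of the standard normal distribution.\<close>

lemma Gaussian_real:
  shows "integrable lborel (\<lambda>u::real. exp (- \<i> * of_real (z * u) - of_real (u\<^sup>2 / 2)))"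
    and "(LINT u|lborel. exp (- \<i> * of_real (z * u) - of_real (u\<^sup>2 / 2)))
      = complex_of_real (sqrt (2 * pi) * exp (- z\<^sup>2 / 2))"
proof -
  have eq: "exp (- \<i> * of_real (z * u) - of_real (u\<^sup>2 / 2))
      = of_real (sqrt (2 * pi)) * (std_normal_density u *\<^sub>R iexp (- z * u))" for u
  proof -
    have "exp (- \<i> * of_real (z * u) - of_real (u\<^sup>2 / 2))
        = exp (of_real (- (u\<^sup>2 / 2))) * iexp (- z * u)"
      by (simp add: exp_diff exp_minus field_simps flip: exp_add)
    also have "exp (complex_of_real (- (u\<^sup>2 / 2))) = of_real (sqrt (2 * pi) * std_normal_density u)"
      by (simp add: std_normal_density_def flip: exp_of_real)
    finally show ?thesis by (simp add: scaleR_conv_of_real)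
  qed
  have int: "integrable lborel (\<lambda>u. std_normal_density u *\<^sub>R iexp (- z * u))"
  proof (rule Bochner_Integration.integrable_bound)
    show "integrable lborel std_normal_density"
      using integrable_std_normal_moment[of 0] by simp
    show "AE u in lborel. norm (std_normal_density u *\<^sub>R iexp (- z * u)) \<le> norm (std_normal_density u)"
      by (intro AE_I2) (simp add: norm_mult)
  qed measurable
  then show "integrable lborel (\<lambda>u::real. exp (- \<i> * of_real (z * u) - of_real (u\<^sup>2 / 2)))"
    unfolding eq by (intro integrable_mult_right)
  have "(LINT u|lborel. std_normal_density u *\<^sub>R iexp (- z * u)) = char std_normal_distribution (- z)"
    unfolding char_def by (subst integral_density) auto
  also have "\<dots> = complex_of_real (exp (- z\<^sup>2 / 2))"
    unfolding char_std_normal_distribution by simp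
  finally show "(LINT u|lborel. exp (- \<i> * of_real (z * u) - of_real (u\<^sup>2 / 2)))
      = complex_of_real (sqrt (2 * pi) * exp (- z\<^sup>2 / 2))"
    unfolding eq integral_mult_right_zero by (simp only: of_real_mult)
qed

text \<open>Both the integrand and Lebesgue measure are products over the coordinates.\<close>

lemma Gaussian_fourier:
  fixes z :: "'a :: euclidean_space"
  shows "integrable lborel (\<lambda>u::'a. exp (- \<i> * of_real (z \<bullet> u) - of_real ((norm u)\<^sup>2 / 2)))"
    and "(LINT u|lborel. exp (- \<i> * of_real (z \<bullet> u) - of_real ((norm u)\<^sup>2 / 2)))
      = complex_of_real (sqrt (2 * pi) ^ DIM('a) * exp (- (norm z)\<^sup>2 / 2))"
proof -
  interpret product_sigma_finite "\<lambda>_::'a. lborel :: real measure" ..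
  let ?g = "\<lambda>b u. exp (- \<i> * of_real ((z \<bullet> b) * u) - of_real (u\<^sup>2 / 2)) :: complex"
  let ?f = "\<lambda>u::'a. exp (- \<i> * of_real (z \<bullet> u) - of_real ((norm u)\<^sup>2 / 2)) :: complex"
  let ?T = "\<lambda>f. \<Sum>b\<in>Basis. f b *\<^sub>R b :: 'a"
  have T: "?T \<in> (\<Pi>\<^sub>M b\<in>Basis. lborel) \<rightarrow>\<^sub>M borel" by measurable
  have norm2: "(norm u)\<^sup>2 = (\<Sum>b\<in>Basis. (u \<bullet> b)\<^sup>2)" for u :: 'a
    unfolding power2_norm_eq_inner by (subst euclidean_inner) (simp add: power2_eq_square)
  have fT: "?f (?T f) = (\<Prod>b\<in>Basis. ?g b (f b))" for f
  proof -
    have "- \<i> * of_real (z \<bullet> ?T f) - of_real ((norm (?T f))\<^sup>2 / 2)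
        = (\<Sum>b\<in>Basis. - \<i> * of_real ((z \<bullet> b) * f b) - of_real ((f b)\<^sup>2 / 2))"
      unfolding norm2
      by (simp add: inner_sum_right sum_subtractf sum_negf sum_distrib_left sum_divide_distrib mult_ac)
    then show ?thesis by (simp add: exp_sum)
  qed
  have fm: "?f \<in> borel_measurable borel" by measurable
  have "integrable (\<Pi>\<^sub>M b\<in>Basis. lborel) (\<lambda>f. \<Prod>b\<in>Basis. ?g b (f b))"
    by (intro product_integrable_prod finite_Basis Gaussian_real)
  then show "integrable lborel ?f"
    unfolding lborel_eq[where 'a='a] by (subst integrable_distr_eq[OF T fm]) (simp only: fT)
  have "(LINT u|lborel. ?f u) = (LINT f|Pi\<^sub>M Basis (\<lambda>_. lborel). (\<Prod>b\<in>Basis. ?g b (f b)))"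
    by (subst lborel_eq, subst integral_distr[OF T fm]) (simp only: fT)
  also have "\<dots> = (\<Prod>b\<in>Basis. LINT u|lborel. ?g b u)"
    by (intro product_integral_prod finite_Basis Gaussian_real)
  also have "\<dots> = (\<Prod>b\<in>Basis. complex_of_real (sqrt (2 * pi) * exp (- (z \<bullet> b)\<^sup>2 / 2)))"
    by (simp only: Gaussian_real)
  also have "\<dots> = complex_of_real (sqrt (2 * pi) ^ DIM('a) * exp (\<Sum>b\<in>Basis. - (z \<bullet> b)\<^sup>2 / 2))"
    by (simp only: of_real_prod[symmetric] prod.distrib prod_constant exp_sum[OF finite_Basis])
  also have "(\<Sum>b\<in>Basis. - (z \<bullet> b)\<^sup>2 / 2) = - (norm z)\<^sup>2 / 2"
    unfolding norm2 by (simp add: sum_negf sum_divide_distrib)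
  finally show "(LINT u|lborel. ?f u) = complex_of_real (sqrt (2 * pi) ^ DIM('a) * exp (- (norm z)\<^sup>2 / 2))" .
qed

section \<open>The Plancherel theorem\<close>

definition fourier :: "('a :: euclidean_space \<Rightarrow> complex) \<Rightarrow> 'a \<Rightarrow> complex" where
  "fourier h \<eta> = (LINT x|lebesgue. h x * cis (- (x \<bullet> \<eta>)))"

lemma borel_measurable_cis [measurable]: "cis \<in> borel_measurable borel"
  unfolding cis_conv_exp by measurable

lemma cis_inner_lebesgue [measurable]:
  "(\<lambda>x :: 'a :: euclidean_space. cis (- (x \<bullet> \<eta>))) \<in> borel_measurable lebesgue"
  by (rule measurable_lborel_imp_lebesgue) measurable

lemma fourier_integrable:
  assumes "integrable lebesgue h"
  shows "integrable lebesgue (\<lambda>x. h x * cis (- (x \<bullet> \<eta>)))"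
proof (rule Bochner_Integration.integrable_bound[OF assms])
  show "(\<lambda>x. h x * cis (- (x \<bullet> \<eta>))) \<in> borel_measurable lebesgue"
    using borel_measurable_integrable[OF assms] by measurable
  show "AE x in lebesgue. norm (h x * cis (- (x \<bullet> \<eta>))) \<le> norm (h x)"
    by (simp add: norm_mult)
qed

lemma fourier_cmod_le: "cmod (fourier h \<eta>) \<le> (LINT x|lebesgue. cmod (h x))"
  unfolding fourier_def
  using integral_norm_bound[of lebesgue "\<lambda>x. h x * cis (- (x \<bullet> \<eta>))"] by (simp add: norm_mult)

lemma fourier_AE_cong:
  assumes "h \<in> borel_measurable lebesgue" "k \<in> borel_measurable lebesgue"
    and "AE x in lebesgue. h x = k x"
  shows "fourier h = fourier k"
  unfolding fourier_def using assms
  by (intro ext integral_cong_AE) (measurable, auto)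

lemma fourier_eq_lborel:
  assumes [measurable]: "h \<in> borel_measurable borel"
  shows "fourier h \<eta> = (LINT x|lborel. h x * cis (- (x \<bullet> \<eta>)))"
  unfolding fourier_def by (rule integral_completion) measurable

lemma fourier_measurable_borel:
  assumes [measurable]: "h \<in> borel_measurable borel"
  shows "fourier h \<in> borel_measurable borel"
  unfolding fourier_eq_lborel[OF assms, abs_def]
  by (rule lborel.borel_measurable_lebesgue_integral[where N = borel]) measurable

lemma fourier_measurable [measurable]:
  assumes "h \<in> borel_measurable lebesgue"
  shows "fourier h \<in> borel_measurable borel"
proof -
  obtain k where k: "k \<in> borel_measurable borel" "AE x in lebesgue. h x = k x"
    using lebesgue_ex_borel[OF assms] .
  have "fourier h = fourier k"
    by (rule fourier_AE_cong[OF assms measurable_lborel_imp_lebesgue[OF k(1)] k(2)])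
  then show ?thesis using fourier_measurable_borel[OF k(1)] by simp
qed

text \<open>Fubini's theorem for \<open>h x * m \<eta> * cis (- (x \<bullet> \<eta>))\<close>.\<close>

lemma fourier_multiplication:
  fixes h m :: "'a :: euclidean_space \<Rightarrow> complex"
  assumes h: "integrable lborel h" and m: "integrable lborel m"
  shows "(LINT \<eta>|lborel. fourier h \<eta> * m \<eta>) = (LINT x|lborel. h x * fourier m x)"
proof -
  have [measurable]: "h \<in> borel_measurable borel" "m \<in> borel_measurable borel"
    using borel_measurable_integrable[OF h] borel_measurable_integrable[OF m] by auto
  let ?f = "\<lambda>x \<eta>. h x * m \<eta> * cis (- (x \<bullet> \<eta>))"
  have meas: "case_prod ?f \<in> borel_measurable (lborel \<Otimes>\<^sub>M lborel)"
    by measurable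
  have "integrable (lborel \<Otimes>\<^sub>M lborel) (case_prod ?f)"
  proof (rule lborel_pair.Fubini_integrable[OF meas])
    show "integrable lborel (\<lambda>x. LINT \<eta>|lborel. norm (case_prod ?f (x, \<eta>)))"
      using h by (simp add: norm_mult)
    show "AE x in lborel. integrable lborel (\<lambda>\<eta>. case_prod ?f (x, \<eta>))"
    proof (intro AE_I2)
      fix x
      have "integrable lborel (\<lambda>\<eta>. h x * m \<eta>)" using m by simp
      then show "integrable lborel (\<lambda>\<eta>. case_prod ?f (x, \<eta>))"
        by (rule Bochner_Integration.integrable_bound)
           (simp_all add: norm_mult)
    qed
  qed
  then have "(LINT \<eta>|lborel. LINT x|lborel. ?f x \<eta>) = (LINT x|lborel. LINT \<eta>|lborel. ?f x \<eta>)"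
    by (rule lborel_pair.Fubini_integral)
  moreover have "(LINT x|lborel. ?f x \<eta>) = fourier h \<eta> * m \<eta>" for \<eta>
    by (subst fourier_eq_lborel, measurable)
       (simp add: mult_ac flip: integral_mult_right_zero)
  moreover have "(LINT \<eta>|lborel. ?f x \<eta>) = h x * fourier m x" for x
    by (subst fourier_eq_lborel, measurable)
       (simp add: mult_ac inner_commute flip: integral_mult_right_zero)
  ultimately show ?thesis by simp
qed

lemma Gaussian_scaled:
  fixes z :: "'a :: euclidean_space"
  assumes t: "t > 0"
  shows "(LINT u|lborel. cis (- (z \<bullet> u)) * of_real (exp (- (norm (t *\<^sub>R u))\<^sup>2 / 2)))
      = complex_of_real ((1 / t) ^ DIM('a) * (sqrt (2 * pi) ^ DIM('a) * exp (- (norm (z /\<^sub>R t))\<^sup>2 / 2)))"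
proof -
  let ?f = "\<lambda>u::'a. cis (- (z \<bullet> u)) * of_real (exp (- (norm (t *\<^sub>R u))\<^sup>2 / 2))"
  let ?g = "\<lambda>u::'a. exp (- \<i> * of_real ((z /\<^sub>R t) \<bullet> u) - of_real ((norm u)\<^sup>2 / 2)) :: complex"
  have fm: "?f \<in> borel_measurable borel" by measurable
  have gm: "?g \<in> borel_measurable borel" by measurable
  have c: "coord_prod ((1 / t) *\<^sub>R One :: 'a) \<noteq> 0" using t by (simp add: coord_prod_One)
  have "(LINT u|lborel. ?f u) = (LINT u|lebesgue. ?f u)"
    using fm by (intro integral_completion[symmetric]) simp
  also have "\<dots> = complex_of_real ((1 / t) ^ DIM('a)) * (LINT u|lebesgue. ?f (0 + (1 / t) *\<^sub>R u))"
    using integral_affine[OF c measurable_lborel_imp_lebesgue[OF fm], of 0] t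
    unfolding coord_scale_One coord_prod_One by simp
  also have "(\<lambda>u. ?f (0 + (1 / t) *\<^sub>R u)) = ?g"
  proof
    fix u
    have "?g u = exp (\<i> * of_real (- ((z /\<^sub>R t) \<bullet> u))) * exp (of_real (- (norm u)\<^sup>2 / 2))"
      by (subst exp_add[symmetric]) simp
    also have "\<dots> = cis (- ((z /\<^sub>R t) \<bullet> u)) * of_real (exp (- (norm u)\<^sup>2 / 2))"
      by (simp only: cis_conv_exp exp_of_real)
    also have "\<dots> = ?f (0 + (1 / t) *\<^sub>R u)"
      using t by (simp add: field_simps)
    finally show "?f (0 + (1 / t) *\<^sub>R u) = ?g u" ..
  qed
  also have "(LINT u|lebesgue. ?g u) = (LINT u|lborel. ?g u)"
    using gm by (intro integral_completion) simp
  also have "\<dots> = complex_of_real (sqrt (2 * pi) ^ DIM('a) * exp (- (norm (z /\<^sub>R t))\<^sup>2 / 2))"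
    by (rule Gaussian_fourier)
  finally show ?thesis by (simp only: of_real_mult)
qed

lemma Gaussian_mass:
  shows "integrable lborel (\<lambda>w::'a::euclidean_space. exp (- (norm w)\<^sup>2 / 2))"
    and "(LINT w|lborel. exp (- (norm (w::'a))\<^sup>2 / 2)) = sqrt (2 * pi) ^ DIM('a)"
proof -
  have eq: "exp (- \<i> * of_real ((0::'a) \<bullet> u) - of_real ((norm u)\<^sup>2 / 2))
      = complex_of_real (exp (- (norm u)\<^sup>2 / 2))" for u :: 'a
    by (simp flip: exp_of_real)
  show "integrable lborel (\<lambda>w::'a. exp (- (norm w)\<^sup>2 / 2))"
    using Gaussian_fourier(1)[of "0::'a"] unfolding eq by (simp only: complex_of_real_integrable_eq)
  have "complex_of_real (LINT w|lborel. exp (- (norm (w::'a))\<^sup>2 / 2)) = of_real (sqrt (2 * pi) ^ DIM('a))"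
    using Gaussian_fourier(2)[of "0::'a"] unfolding eq integral_complex_of_real by simp
  then show "(LINT w|lborel. exp (- (norm (w::'a))\<^sup>2 / 2)) = sqrt (2 * pi) ^ DIM('a)"
    by (simp only: of_real_eq_iff)
qed

lemma Gaussian_scaled_integrable:
  assumes "t > 0"
  shows "integrable lborel (\<lambda>w::'a::euclidean_space. exp (- (norm (t *\<^sub>R w))\<^sup>2 / 2))"
proof -
  have "integrable lebesgue (\<lambda>w::'a. exp (- (norm w)\<^sup>2 / 2))"
    by (subst integrable_completion) (measurable, rule Gaussian_mass)
  then have "integrable lebesgue (\<lambda>w::'a. exp (- (norm (0 + coord_scale (t *\<^sub>R One) w))\<^sup>2 / 2))"
    using assms by (intro integrable_affine) (auto simp: coord_prod_One)
  then have "integrable lebesgue (\<lambda>w::'a. exp (- (norm (t *\<^sub>R w))\<^sup>2 / 2))"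
    by (simp only: coord_scale_One add_0)
  then show ?thesis by (subst (asm) integrable_completion) measurable
qed

text \<open>Two applications of the multiplication formula move the transform from \<open>h\<close> to the Gaussian. The
  transform of a modulated Gaussian of width \<open>1 / t\<close> is a Gaussian of width \<open>t\<close> centred at the modulation
  frequency \<open>x\<close>; the substitution \<open>y = x + t w\<close> removes the dependence of the kernel on \<open>t\<close>.\<close>

lemma Gaussian_regularized:
  fixes h :: "'a :: euclidean_space \<Rightarrow> complex"
  assumes h: "integrable lborel h" and t: "t > 0"
  shows "(LINT \<eta>|lborel. fourier h \<eta> * (cnj (fourier h \<eta>) * of_real (exp (- (norm (t *\<^sub>R \<eta>))\<^sup>2 / 2))))
    = complex_of_real (sqrt (2 * pi) ^ DIM('a)) *
      (LINT x|lborel. h x * cnj (LINT w|lborel. h (x + t *\<^sub>R w) * of_real (exp (- (norm w)\<^sup>2 / 2))))"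
proof -
  let ?E = "\<lambda>\<eta>::'a. exp (- (norm (t *\<^sub>R \<eta>))\<^sup>2 / 2)"
  let ?c = "sqrt (2 * pi) ^ DIM('a)"
  have hm [measurable]: "h \<in> borel_measurable borel"
    using borel_measurable_integrable[OF h] by simp
  have hL: "integrable lebesgue h" using h by (subst integrable_completion) auto
  have Fm [measurable]: "fourier h \<in> borel_measurable borel" by (rule fourier_measurable_borel[OF hm])
  have E: "integrable lborel ?E" by (rule Gaussian_scaled_integrable[OF t])
  have m: "integrable lborel (\<lambda>\<eta>. cnj (fourier h \<eta>) * of_real (?E \<eta>))"
  proof (rule Bochner_Integration.integrable_bound)
    show "integrable lborel (\<lambda>\<eta>. (LINT x|lebesgue. cmod (h x)) * ?E \<eta>)"
      using E by (rule integrable_mult_right)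
    show "AE \<eta> in lborel. norm (cnj (fourier h \<eta>) * of_real (?E \<eta>))
        \<le> norm ((LINT x|lebesgue. cmod (h x)) * ?E \<eta>)"
      using fourier_cmod_le[of h] by (simp add: norm_mult abs_mult)
  qed measurable
  have inner: "fourier (\<lambda>\<eta>. cnj (fourier h \<eta>) * of_real (?E \<eta>)) x
      = of_real ?c * cnj (LINT w|lborel. h (x + t *\<^sub>R w) * of_real (exp (- (norm w)\<^sup>2 / 2)))" for x
  proof -
    let ?m = "\<lambda>\<eta>. cis (x \<bullet> \<eta>) * of_real (?E \<eta>)"
    let ?k = "\<lambda>y. h y * of_real ((1 / t) ^ DIM('a) * (?c * exp (- (norm ((y - x) /\<^sub>R t))\<^sup>2 / 2)))"
    have m': "integrable lborel ?m"
      by (rule Bochner_Integration.integrable_bound[OF E]) (measurable, simp add: norm_mult)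
    have fm': "fourier ?m y = of_real ((1 / t) ^ DIM('a) * (?c * exp (- (norm ((y - x) /\<^sub>R t))\<^sup>2 / 2)))" for y
    proof -
      have "fourier ?m y = (LINT u|lborel. cis (- ((y - x) \<bullet> u)) * of_real (?E u))"
      proof -
        have "?m u * cis (- (u \<bullet> y)) = cis (- ((y - x) \<bullet> u)) * of_real (?E u)" for u
        proof -
          have "cis (x \<bullet> u) * cis (- (u \<bullet> y)) = cis (- ((y - x) \<bullet> u))"
            by (simp add: cis_mult inner_diff_left inner_commute[of u])
          then show ?thesis by (metis mult.commute mult.left_commute)
        qed
        moreover have "?m \<in> borel_measurable borel" by measurable
        ultimately show ?thesis by (simp only: fourier_eq_lborel)
      qed
      then show ?thesis by (simp only: Gaussian_scaled[OF t])
    qed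
    have km: "?k \<in> borel_measurable borel" by measurable
    have c: "coord_prod (t *\<^sub>R One :: 'a) \<noteq> 0" using t by (simp add: coord_prod_One)
    have "fourier (\<lambda>\<eta>. cnj (fourier h \<eta>) * of_real (?E \<eta>)) x
        = (LINT \<eta>|lborel. cnj (fourier h \<eta> * ?m \<eta>))"
      by (subst fourier_eq_lborel, measurable) (simp add: inner_commute cis_cnj mult_ac)
    also have "\<dots> = cnj (LINT \<eta>|lborel. fourier h \<eta> * ?m \<eta>)"
      by (rule Bochner_Integration.integral_cnj)
    also have "(LINT \<eta>|lborel. fourier h \<eta> * ?m \<eta>) = (LINT y|lborel. ?k y)"
      unfolding fourier_multiplication[OF h m'] fm' ..
    also have "\<dots> = (LINT y|lebesgue. ?k y)"
      using km by (intro integral_completion[symmetric]) simp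
    also have "\<dots> = complex_of_real (t ^ DIM('a)) * (LINT w|lebesgue. ?k (x + t *\<^sub>R w))"
      using integral_affine[OF c measurable_lborel_imp_lebesgue[OF km], of x] t
      unfolding coord_scale_One coord_prod_One by simp
    also have "(LINT w|lebesgue. ?k (x + t *\<^sub>R w)) = (LINT w|lborel. ?k (x + t *\<^sub>R w))"
      by (intro integral_completion) measurable
    also have "\<dots> = (LINT w|lborel. complex_of_real ((1 / t) ^ DIM('a) * ?c) *
        (h (x + t *\<^sub>R w) * of_real (exp (- (norm w)\<^sup>2 / 2))))"
      using t by (intro Bochner_Integration.integral_cong) auto
    also have "\<dots> = complex_of_real ((1 / t) ^ DIM('a) * ?c) *
        (LINT w|lborel. h (x + t *\<^sub>R w) * of_real (exp (- (norm w)\<^sup>2 / 2)))"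
      by (rule integral_mult_right_zero)
    also have "complex_of_real (t ^ DIM('a)) * (complex_of_real ((1 / t) ^ DIM('a) * ?c) *
        (LINT w|lborel. h (x + t *\<^sub>R w) * of_real (exp (- (norm w)\<^sup>2 / 2))))
      = complex_of_real ?c * (LINT w|lborel. h (x + t *\<^sub>R w) * of_real (exp (- (norm w)\<^sup>2 / 2)))"
      using t by (simp add: power_divide)
    finally show ?thesis by simp
  qed
  show ?thesis
    unfolding fourier_multiplication[OF h m] inner
    by (simp only: integral_mult_right_zero[symmetric] mult.left_commute)
qed

text \<open>Exchange of the order of integration; integrability on the product holds since, by Cauchy--Schwarz, the
  autocorrelation of \<open>|h|\<close> is bounded by the squared norm.\<close>

lemma Gaussian_autocorrelation:
  fixes h :: "'a :: euclidean_space \<Rightarrow> complex"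
  assumes h: "h \<in> L2_space" and hm [measurable]: "h \<in> borel_measurable borel"
  shows "(LINT x|lborel. h x * cnj (LINT w|lborel. h (x + t *\<^sub>R w) * of_real (exp (- (norm w)\<^sup>2 / 2))))
    = (LINT w|lborel. of_real (exp (- (norm w)\<^sup>2 / 2)) * L2_inner h (\<lambda>x. h (t *\<^sub>R w + x)))"
proof -
  let ?e = "\<lambda>w::'a. exp (- (norm w)\<^sup>2 / 2)"
  let ?f = "\<lambda>w x. of_real (?e w) * (h x * cnj (h (t *\<^sub>R w + x)))"
  note tr = L2_translate
  have int: "integrable lborel (\<lambda>x. h x * cnj (h (t *\<^sub>R w + x)))" for w
    using L2_mult_integrable[OF h tr(1)[OF h]]
    by (subst (asm) integrable_completion) measurable
  have habs: "(\<lambda>x. complex_of_real (cmod (h x))) \<in> L2_space"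
    using h L2_spaceD[OF h] by (simp add: L2_space_def)
  have meas: "case_prod ?f \<in> borel_measurable (lborel \<Otimes>\<^sub>M lborel)" by measurable
  have "integrable (lborel \<Otimes>\<^sub>M lborel) (case_prod ?f)"
  proof (rule lborel_pair.Fubini_integrable[OF meas])
    show "AE w in lborel. integrable lborel (\<lambda>x. case_prod ?f (w, x))"
      using int by simp
    show "integrable lborel (\<lambda>w. LINT x|lborel. norm (case_prod ?f (w, x)))"
    proof (rule Bochner_Integration.integrable_bound)
      show "integrable lborel (\<lambda>w. (L2_norm h)\<^sup>2 * ?e w)"
        by (intro integrable_mult_right Gaussian_mass)
      show "AE w in lborel. norm (LINT x|lborel. norm (case_prod ?f (w, x))) \<le> norm ((L2_norm h)\<^sup>2 * ?e w)"
      proof (intro AE_I2)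
        fix w
        let ?a = "\<lambda>x. complex_of_real (cmod (h x))"
        let ?b = "\<lambda>x. complex_of_real (cmod (h (t *\<^sub>R w + x)))"
        have "complex_of_real (LINT x|lborel. norm (case_prod ?f (w, x)))
            = (LINT x|lborel. of_real (?e w) * (?a x * cnj (?b x)))"
          unfolding integral_complex_of_real[symmetric]
          by (intro Bochner_Integration.integral_cong) (auto simp: norm_mult)
        also have "\<dots> = of_real (?e w) * (LINT x|lborel. ?a x * cnj (?b x))"
          by (rule integral_mult_right_zero)
        also have "(LINT x|lborel. ?a x * cnj (?b x)) = L2_inner ?a ?b"
          unfolding L2_inner_def by (rule integral_completion[symmetric]) measurable
        finally have c: "complex_of_real (LINT x|lborel. norm (case_prod ?f (w, x))) = of_real (?e w) * L2_inner ?a ?b" .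
        have "norm (LINT x|lborel. norm (case_prod ?f (w, x)))
            = norm (complex_of_real (LINT x|lborel. norm (case_prod ?f (w, x))))"
          by (simp only: norm_of_real real_norm_def)
        also note c
        also have "cmod (of_real (?e w) * L2_inner ?a ?b) \<le> ?e w * (L2_norm ?a * L2_norm ?b)"
          unfolding norm_mult norm_of_real abs_exp_cancel
          by (intro mult_left_mono L2_Cauchy_Schwarz[OF habs tr(1)[OF habs]]) simp
        also have "L2_norm ?b = L2_norm ?a" by (rule tr(2)[OF habs])
        also have "L2_norm ?a = L2_norm h" by (simp add: L2_norm_def)
        finally show "norm (LINT x|lborel. norm (case_prod ?f (w, x))) \<le> norm ((L2_norm h)\<^sup>2 * ?e w)"
          by (simp add: power2_eq_square mult.commute)
      qed
    qed measurable
  qed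
  then have "(LINT x|lborel. LINT w|lborel. ?f w x) = (LINT w|lborel. LINT x|lborel. ?f w x)"
    by (rule lborel_pair.Fubini_integral)
  moreover have "(LINT w|lborel. ?f w x)
      = h x * cnj (LINT w|lborel. h (x + t *\<^sub>R w) * of_real (?e w))" for x
    by (subst Bochner_Integration.integral_cnj[symmetric], subst integral_mult_right_zero[symmetric])
       (intro Bochner_Integration.integral_cong, auto simp: add.commute)
  moreover have "(LINT x|lborel. ?f w x) = of_real (?e w) * L2_inner h (\<lambda>x. h (t *\<^sub>R w + x))" for w
  proof -
    have "L2_inner h (\<lambda>x. h (t *\<^sub>R w + x)) = (LINT x|lborel. h x * cnj (h (t *\<^sub>R w + x)))"
      unfolding L2_inner_def by (rule integral_completion) measurable
    then show ?thesis by (simp only: integral_mult_right_zero)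
  qed
  ultimately show ?thesis by simp
qed

text \<open>The limit \<open>t \<rightarrow> 0\<close> in the two preceding identities. The autocorrelation \<open>A\<close> is bounded, and
  continuous at 0 with value \<open>(L2_norm h)\<^sup>2\<close>, so dominated convergence applies to the Gaussian average. On the
  other side the Gaussian factor increases to 1, so monotone convergence yields the integral of
  \<open>|fourier h|\<^sup>2\<close>, whose finiteness is part of the conclusion.\<close>

lemma Plancherel_borel:
  fixes h :: "'a :: euclidean_space \<Rightarrow> complex"
  assumes h1: "integrable lborel h" and h: "h \<in> L2_space"
  shows "(\<integral>\<^sup>+\<eta>. ennreal ((cmod (fourier h \<eta>))\<^sup>2) \<partial>lborel) = ennreal ((2 * pi) ^ DIM('a) * (L2_norm h)\<^sup>2)"
proof -
  let ?e = "\<lambda>w::'a. exp (- (norm w)\<^sup>2 / 2)"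
  let ?c = "sqrt (2 * pi) ^ DIM('a)"
  define A where "A z = L2_inner h (\<lambda>x. h (z + x))" for z
  define t where "t n = inverse (real (Suc n))" for n
  have t0: "t n > 0" for n by (simp add: t_def)
  have tlim: "t \<longlonglongrightarrow> 0" unfolding t_def by (rule LIMSEQ_inverse_real_of_nat)
  have hm [measurable]: "h \<in> borel_measurable borel"
    using borel_measurable_integrable[OF h1] by simp
  have Fm [measurable]: "fourier h \<in> borel_measurable borel" by (rule fourier_measurable_borel[OF hm])
  note tr = L2_translate
  have A_eq: "A z = (LINT x|lborel. h x * cnj (h (z + x)))" for z
    unfolding A_def L2_inner_def by (rule integral_completion) measurable
  have Am [measurable]: "A \<in> borel_measurable borel"
    unfolding A_eq[abs_def]
    by (rule lborel.borel_measurable_lebesgue_integral[where N = borel]) measurable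
  have A_le: "cmod (A z) \<le> (L2_norm h)\<^sup>2" for z
    using L2_Cauchy_Schwarz[OF h tr(1)[OF h]] tr(2)[OF h] by (simp add: A_def power2_eq_square)
  have A_lim: "(\<lambda>n. A (z n)) \<longlonglongrightarrow> of_real ((L2_norm h)\<^sup>2)" if z: "z \<longlonglongrightarrow> 0" for z
  proof (rule LIM_zero_cancel, rule Lim_null_comparison)
    show "\<forall>\<^sub>F n in sequentially. norm (A (z n) - of_real ((L2_norm h)\<^sup>2))
        \<le> L2_norm h * L2_norm (\<lambda>x. h (z n + x) - h x)"
    proof (intro always_eventually allI)
      fix n
      have "A (z n) - of_real ((L2_norm h)\<^sup>2) = L2_inner h (\<lambda>x. h (z n + x) - h x)"
        unfolding A_def L2_norm_eq_inner[symmetric] by (rule L2_inner_diff_right[OF tr(1)[OF h] h h, symmetric])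
      then show "norm (A (z n) - of_real ((L2_norm h)\<^sup>2)) \<le> L2_norm h * L2_norm (\<lambda>x. h (z n + x) - h x)"
        using L2_Cauchy_Schwarz[OF h L2_space_diff[OF tr(1)[OF h] h]] by simp
    qed
    have "(\<lambda>n. L2_norm (\<lambda>x. h (z n + x) - h x)) \<longlonglongrightarrow> 0"
      using L2_translation_continuous[OF h z] L2_tendsto_iff[OF tr(1)[OF h] h] by simp
    from tendsto_mult_left[OF this, of "L2_norm h"]
    show "(\<lambda>n. L2_norm h * L2_norm (\<lambda>x. h (z n + x) - h x)) \<longlonglongrightarrow> 0" by simp
  qed
  define L where "L n = (LINT \<eta>|lborel. (cmod (fourier h \<eta>))\<^sup>2 * ?e (t n *\<^sub>R \<eta>))" for n
  have L_eq: "complex_of_real (L n) = of_real ?c * (LINT w|lborel. of_real (?e w) * A (t n *\<^sub>R w))" for n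
  proof -
    have "complex_of_real (L n) = (LINT \<eta>|lborel. fourier h \<eta> * (cnj (fourier h \<eta>) * of_real (?e (t n *\<^sub>R \<eta>))))"
      unfolding L_def integral_complex_of_real[symmetric]
      by (intro Bochner_Integration.integral_cong)
         (simp_all add: mult.assoc[symmetric] flip: complex_norm_square of_real_power)
    then show ?thesis
      unfolding Gaussian_regularized[OF h1 t0] Gaussian_autocorrelation[OF h hm] A_def .
  qed
  have "(\<lambda>n. LINT w|lborel. of_real (?e w) * A (t n *\<^sub>R w))
      \<longlonglongrightarrow> (LINT w|lborel. of_real (?e w) * of_real ((L2_norm h)\<^sup>2))"
  proof (rule integral_dominated_convergence[where w = "\<lambda>w. ?e w * (L2_norm h)\<^sup>2"])
    show "integrable lborel (\<lambda>w. ?e w * (L2_norm h)\<^sup>2)"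
      by (intro integrable_mult_left Gaussian_mass)
    show "AE w in lborel. (\<lambda>n. of_real (?e w) * A (t n *\<^sub>R w)) \<longlonglongrightarrow> of_real (?e w) * of_real ((L2_norm h)\<^sup>2)"
    proof (intro AE_I2 tendsto_mult_left A_lim)
      fix w :: 'a
      show "(\<lambda>n. t n *\<^sub>R w) \<longlonglongrightarrow> 0" using tendsto_scaleR[OF tlim tendsto_const[of w]] by simp
    qed
    show "AE w in lborel. norm (of_real (?e w) * A (t n *\<^sub>R w)) \<le> ?e w * (L2_norm h)\<^sup>2" for n
      using A_le by (simp add: norm_mult)
  qed measurable
  also have "(LINT w|lborel. of_real (?e w) * of_real ((L2_norm h)\<^sup>2))
      = complex_of_real (?c * (L2_norm h)\<^sup>2)"
    unfolding of_real_mult[symmetric] integral_complex_of_real integral_mult_left_zero Gaussian_mass ..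
  finally have "(\<lambda>n. complex_of_real (L n)) \<longlonglongrightarrow> of_real ?c * complex_of_real (?c * (L2_norm h)\<^sup>2)"
    unfolding L_eq by (intro tendsto_mult_left)
  also have "of_real ?c * complex_of_real (?c * (L2_norm h)\<^sup>2)
      = complex_of_real ((2 * pi) ^ DIM('a) * (L2_norm h)\<^sup>2)"
  proof -
    have "?c * ?c = (2 * pi) ^ DIM('a)" by (subst power_mult_distrib[symmetric]) simp
    then have "?c * (?c * (L2_norm h)\<^sup>2) = (2 * pi) ^ DIM('a) * (L2_norm h)\<^sup>2"
      by (simp only: mult.assoc[symmetric])
    then show ?thesis by (simp only: of_real_mult[symmetric])
  qed
  finally have L_lim: "L \<longlonglongrightarrow> (2 * pi) ^ DIM('a) * (L2_norm h)\<^sup>2"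
    by (simp only: tendsto_of_real_iff)
  have "(\<integral>\<^sup>+\<eta>. ennreal ((cmod (fourier h \<eta>))\<^sup>2 * ?e (t n *\<^sub>R \<eta>)) \<partial>lborel) = ennreal (L n)" for n
    unfolding L_def
  proof (rule nn_integral_eq_integral)
    show "integrable lborel (\<lambda>\<eta>. (cmod (fourier h \<eta>))\<^sup>2 * ?e (t n *\<^sub>R \<eta>))"
    proof (rule Bochner_Integration.integrable_bound)
      show "integrable lborel (\<lambda>\<eta>. (LINT x|lebesgue. cmod (h x))\<^sup>2 * ?e (t n *\<^sub>R \<eta>))"
        using Gaussian_scaled_integrable[OF t0] by (rule integrable_mult_right)
      show "AE \<eta> in lborel. norm ((cmod (fourier h \<eta>))\<^sup>2 * ?e (t n *\<^sub>R \<eta>))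
          \<le> norm ((LINT x|lebesgue. cmod (h x))\<^sup>2 * ?e (t n *\<^sub>R \<eta>))"
        using power_mono[OF fourier_cmod_le norm_ge_zero, of h _ 2] by simp
    qed measurable
  qed simp
  moreover have "(\<lambda>n. \<integral>\<^sup>+\<eta>. ennreal ((cmod (fourier h \<eta>))\<^sup>2 * ?e (t n *\<^sub>R \<eta>)) \<partial>lborel)
      \<longlonglongrightarrow> (\<integral>\<^sup>+\<eta>. ennreal ((cmod (fourier h \<eta>))\<^sup>2) \<partial>lborel)"
  proof (rule nn_integral_LIMSEQ)
    show "incseq (\<lambda>n \<eta>. ennreal ((cmod (fourier h \<eta>))\<^sup>2 * ?e (t n *\<^sub>R \<eta>)))"
    proof (intro incseq_SucI le_funI ennreal_leI mult_left_mono)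
      fix n and \<eta> :: 'a
      have "t (Suc n) \<le> t n" by (simp add: t_def)
      then have "norm (t (Suc n) *\<^sub>R \<eta>) \<le> norm (t n *\<^sub>R \<eta>)"
        using t0[of n] t0[of "Suc n"] by (simp add: mult_right_mono)
      then have "(norm (t (Suc n) *\<^sub>R \<eta>))\<^sup>2 \<le> (norm (t n *\<^sub>R \<eta>))\<^sup>2" by (intro power_mono) auto
      then show "?e (t n *\<^sub>R \<eta>) \<le> ?e (t (Suc n) *\<^sub>R \<eta>)" by simp
    qed simp
    show "(\<lambda>n. ennreal ((cmod (fourier h \<eta>))\<^sup>2 * ?e (t n *\<^sub>R \<eta>))) \<longlonglongrightarrow> ennreal ((cmod (fourier h \<eta>))\<^sup>2)" for \<eta>
    proof (rule tendsto_ennrealI)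
      have "(\<lambda>n. (cmod (fourier h \<eta>))\<^sup>2 * ?e (t n *\<^sub>R \<eta>)) \<longlonglongrightarrow> (cmod (fourier h \<eta>))\<^sup>2 * ?e (0 *\<^sub>R \<eta>)"
        by (intro tendsto_intros tlim) simp
      then show "(\<lambda>n. (cmod (fourier h \<eta>))\<^sup>2 * ?e (t n *\<^sub>R \<eta>)) \<longlonglongrightarrow> (cmod (fourier h \<eta>))\<^sup>2" by simp
    qed
  qed measurable
  ultimately have "(\<lambda>n. ennreal (L n)) \<longlonglongrightarrow> (\<integral>\<^sup>+\<eta>. ennreal ((cmod (fourier h \<eta>))\<^sup>2) \<partial>lborel)" by simp
  then show ?thesis
    using tendsto_ennrealI[OF L_lim] by (rule LIMSEQ_unique)
qed

theorem Plancherel_L1_L2: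
  fixes h :: "'a :: euclidean_space \<Rightarrow> complex"
  assumes "h \<in> L1_space \<inter> L2_space"
  shows "fourier h \<in> L2_space" "(L2_norm (fourier h))\<^sup>2 = (2 * pi) ^ DIM('a) * (L2_norm h)\<^sup>2"
proof -
  have h1: "integrable lebesgue h" and h2: "h \<in> L2_space"
    using assms by (auto simp: L1_space_def)
  obtain k where k: "k \<in> borel_measurable borel" "AE x in lebesgue. h x = k x"
    using lebesgue_ex_borel[OF L2_spaceD(1)[OF h2]] .
  have kL: "k \<in> borel_measurable lebesgue" by (rule measurable_lborel_imp_lebesgue[OF k(1)])
  have F: "fourier h = fourier k" by (rule fourier_AE_cong[OF L2_spaceD(1)[OF h2] kL k(2)])
  have "integrable lebesgue k"
    using integrable_cong_AE[OF L2_spaceD(1)[OF h2] kL k(2)] h1 by simp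
  then have k1: "integrable lborel k" using k(1) by (subst (asm) integrable_completion) auto
  have eq: "(\<integral>\<^sup>+x. ennreal ((cmod (k x))\<^sup>2) \<partial>lebesgue) = ennreal ((L2_norm h)\<^sup>2)"
    unfolding nn_integral_L2_norm[OF h2, symmetric]
    using k(2) by (intro nn_integral_cong_AE) auto
  note k2 = L2_norm_eqI[OF kL eq zero_le_power2]
  have "(\<integral>\<^sup>+\<eta>. ennreal ((cmod (fourier h \<eta>))\<^sup>2) \<partial>lebesgue)
      = ennreal ((2 * pi) ^ DIM('a) * (L2_norm h)\<^sup>2)"
    unfolding nn_integral_completion F Plancherel_borel[OF k1 k2(1)] k2(2) ..
  note eqI = L2_norm_eqI[OF _ this]
  have "fourier h \<in> borel_measurable lebesgue"
    by (intro measurable_lborel_imp_lebesgue fourier_measurable L2_spaceD(1)[OF h2])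
  from eqI[OF this] show "fourier h \<in> L2_space" "(L2_norm (fourier h))\<^sup>2 = (2 * pi) ^ DIM('a) * (L2_norm h)\<^sup>2"
    by simp_all
qed

section \<open>The Fourier transform on L2\<close>

text \<open>A relation, since an \<open>L\<^sup>2\<close> Fourier transform is determined only up to null sets. The quantification over
  all approximating sequences matches the one in \<^const>\<open>is_mfrft\<close>.\<close>

definition is_L2_fourier :: "('a :: euclidean_space \<Rightarrow> complex) \<Rightarrow> ('a \<Rightarrow> complex) \<Rightarrow> bool" where
  "is_L2_fourier f F \<longleftrightarrow> F \<in> L2_space \<and>
     (\<forall>h. (\<forall>n. h n \<in> L1_space \<inter> L2_space) \<longrightarrow> L2_tendsto h f \<longrightarrow> L2_tendsto (\<lambda>n. fourier (h n)) F)"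

lemma fourier_add_scale:
  assumes "integrable lebesgue h" "integrable lebesgue k"
  shows "fourier (\<lambda>x. h x + c * k x) \<eta> = fourier h \<eta> + c * fourier k \<eta>"
  using fourier_integrable[OF assms(1), of \<eta>] fourier_integrable[OF assms(2), of \<eta>]
  by (simp add: fourier_def distrib_right mult.assoc)

lemma L1_L2_add_scale:
  assumes "h \<in> L1_space \<inter> L2_space" "k \<in> L1_space \<inter> L2_space"
  shows "(\<lambda>x. h x + c * k x) \<in> L1_space \<inter> L2_space"
  using assms by (auto simp: L1_space_def intro!: L2_space_add L2_space_scale)

lemma fourier_dist:
  fixes h k :: "'a :: euclidean_space \<Rightarrow> complex"
  assumes "h \<in> L1_space \<inter> L2_space" "k \<in> L1_space \<inter> L2_space"
  shows "L2_norm (\<lambda>x. fourier h x - fourier k x) = sqrt ((2 * pi) ^ DIM('a)) * L2_norm (\<lambda>x. h x - k x)"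
proof -
  have eq: "fourier (\<lambda>x. h x + (-1) * k x) = (\<lambda>x. fourier h x - fourier k x)"
    using assms by (subst fun_eq_iff, subst fourier_add_scale) (auto simp: L1_space_def)
  have "(L2_norm (\<lambda>x. fourier h x - fourier k x))\<^sup>2 = (2 * pi) ^ DIM('a) * (L2_norm (\<lambda>x. h x - k x))\<^sup>2"
    using Plancherel_L1_L2(2)[OF L1_L2_add_scale[OF assms, of "-1"]] unfolding eq by simp
  then have "sqrt ((L2_norm (\<lambda>x. fourier h x - fourier k x))\<^sup>2)
      = sqrt ((2 * pi) ^ DIM('a) * (L2_norm (\<lambda>x. h x - k x))\<^sup>2)" by simp
  then show ?thesis by (simp add: real_sqrt_mult)
qed

text \<open>One approximating sequence suffices: by \<open>fourier_dist\<close> two sequences with the same limit have transforms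
  whose distance tends to 0.\<close>

lemma is_L2_fourierI:
  fixes f F :: "'a :: euclidean_space \<Rightarrow> complex"
  assumes f: "f \<in> L2_space" and F: "F \<in> L2_space"
    and h: "\<And>n. h n \<in> L1_space \<inter> L2_space"
    and hf: "L2_tendsto h f" and hF: "L2_tendsto (\<lambda>n. fourier (h n)) F"
  shows "is_L2_fourier f F"
  unfolding is_L2_fourier_def
proof (intro conjI allI impI F)
  fix k assume "\<forall>n. k n \<in> L1_space \<inter> L2_space" and kf: "L2_tendsto k f"
  then have k: "k n \<in> L1_space \<inter> L2_space" for n by auto
  from h k have h2: "h n \<in> L2_space" and k2: "k n \<in> L2_space" for n by auto
  note Fh = Plancherel_L1_L2(1)[OF h] and Fk = Plancherel_L1_L2(1)[OF k]
  let ?s = "sqrt ((2 * pi) ^ DIM('a))"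
  have "(\<lambda>n. L2_norm (\<lambda>x. fourier (k n) x - F x)) \<longlonglongrightarrow> 0"
  proof (rule Lim_null_comparison)
    show "\<forall>\<^sub>F n in sequentially. norm (L2_norm (\<lambda>x. fourier (k n) x - F x))
        \<le> ?s * (L2_norm (\<lambda>x. k n x - f x) + L2_norm (\<lambda>x. h n x - f x))
          + L2_norm (\<lambda>x. fourier (h n) x - F x)"
    proof (intro always_eventually allI)
      fix n
      have "L2_norm (\<lambda>x. fourier (k n) x - F x)
          \<le> L2_norm (\<lambda>x. fourier (k n) x - fourier (h n) x) + L2_norm (\<lambda>x. fourier (h n) x - F x)"
        by (rule L2_norm_triangle_diff[OF Fk Fh F])
      also have "L2_norm (\<lambda>x. fourier (k n) x - fourier (h n) x) = ?s * L2_norm (\<lambda>x. k n x - h n x)"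
        by (rule fourier_dist[OF k h])
      also have "\<dots> \<le> ?s * (L2_norm (\<lambda>x. k n x - f x) + L2_norm (\<lambda>x. h n x - f x))"
        using L2_norm_triangle_diff[OF k2 f h2, of n n] L2_norm_minus_commute[of f "h n"]
        by (intro mult_left_mono) auto
      finally show "norm (L2_norm (\<lambda>x. fourier (k n) x - F x))
          \<le> ?s * (L2_norm (\<lambda>x. k n x - f x) + L2_norm (\<lambda>x. h n x - f x))
            + L2_norm (\<lambda>x. fourier (h n) x - F x)" by simp
    qed
    have "(\<lambda>n. ?s * (L2_norm (\<lambda>x. k n x - f x) + L2_norm (\<lambda>x. h n x - f x))
            + L2_norm (\<lambda>x. fourier (h n) x - F x)) \<longlonglongrightarrow> ?s * (0 + 0) + 0"
      using kf hf hF unfolding L2_tendsto_iff[OF k2 f] L2_tendsto_iff[OF h2 f] L2_tendsto_iff[OF Fh F]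
      by (intro tendsto_add tendsto_mult_left)
    then show "(\<lambda>n. ?s * (L2_norm (\<lambda>x. k n x - f x) + L2_norm (\<lambda>x. h n x - f x))
            + L2_norm (\<lambda>x. fourier (h n) x - F x)) \<longlonglongrightarrow> 0" by simp
  qed
  then show "L2_tendsto (\<lambda>n. fourier (k n)) F"
    unfolding L2_tendsto_iff[OF Fk F] .
qed

lemma L2_fourier_exists:
  fixes f :: "'a :: euclidean_space \<Rightarrow> complex"
  assumes f: "f \<in> L2_space"
  obtains F where "is_L2_fourier f F"
proof -
  obtain h where h: "\<And>n::nat. h n \<in> L1_space \<inter> L2_space" and hf: "L2_tendsto h f"
    using L2_dense_L1[OF f] by blast
  from h have h2: "h n \<in> L2_space" for n by auto
  let ?s = "sqrt ((2 * pi) ^ DIM('a))"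
  have s: "?s > 0" by simp
  obtain F where "F \<in> L2_space" "L2_tendsto (\<lambda>n. fourier (h n)) F"
  proof (rule L2_complete[OF Plancherel_L1_L2(1)[OF h]])
    fix e :: real assume e: "e > 0"
    have "(\<lambda>n. L2_norm (\<lambda>x. h n x - f x)) \<longlonglongrightarrow> 0"
      using hf by (simp only: L2_tendsto_iff[OF h2 f])
    then have "\<forall>\<^sub>F n in sequentially. L2_norm (\<lambda>x. h n x - f x) < e / (2 * ?s)"
      using e s by (intro order_tendstoD(2)) auto
    then obtain N where N: "\<And>n. n \<ge> N \<Longrightarrow> L2_norm (\<lambda>x. h n x - f x) < e / (2 * ?s)"
      by (auto simp: eventually_sequentially)
    have "L2_norm (\<lambda>x. fourier (h m) x - fourier (h n) x) < e" if "m \<ge> N" "n \<ge> N" for m n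
    proof -
      have "L2_norm (\<lambda>x. h m x - h n x) < e / (2 * ?s) + e / (2 * ?s)"
        using L2_norm_triangle_diff[OF h2[of m] f h2[of n]] N[OF that(1)] N[OF that(2)]
          L2_norm_minus_commute[of f "h n"] by linarith
      also have "\<dots> = e / ?s" using s by (simp add: field_simps)
      finally show ?thesis
        unfolding fourier_dist[OF h h] using s by (simp add: pos_less_divide_eq mult.commute)
    qed
    then show "\<exists>N. \<forall>m\<ge>N. \<forall>n\<ge>N. L2_norm (\<lambda>x. fourier (h m) x - fourier (h n) x) < e" by blast
  qed
  with is_L2_fourierI[OF f _ h hf] that show thesis by blast
qed

lemma L2_fourier_norm:
  fixes f F :: "'a :: euclidean_space \<Rightarrow> complex"
  assumes f: "f \<in> L2_space" and F: "is_L2_fourier f F"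
  shows "(L2_norm F)\<^sup>2 = (2 * pi) ^ DIM('a) * (L2_norm f)\<^sup>2"
proof -
  obtain h where h: "\<And>n::nat. h n \<in> L1_space \<inter> L2_space" and hf: "L2_tendsto h f"
    using L2_dense_L1[OF f] by blast
  from h have h2: "h n \<in> L2_space" for n by auto
  have F2: "F \<in> L2_space" and hF: "L2_tendsto (\<lambda>n. fourier (h n)) F"
    using F h hf by (auto simp: is_L2_fourier_def)
  have "(\<lambda>n. (L2_norm (fourier (h n)))\<^sup>2) \<longlonglongrightarrow> (L2_norm F)\<^sup>2"
    by (intro tendsto_power L2_tendsto_norm[OF Plancherel_L1_L2(1)[OF h] F2 hF])
  moreover have "(\<lambda>n. (L2_norm (fourier (h n)))\<^sup>2) \<longlonglongrightarrow> (2 * pi) ^ DIM('a) * (L2_norm f)\<^sup>2"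
    unfolding Plancherel_L1_L2(2)[OF h]
    by (intro tendsto_mult_left tendsto_power L2_tendsto_norm[OF h2 f hf])
  ultimately show ?thesis by (rule LIMSEQ_unique)
qed

lemma L2_space_mult:
  assumes m: "m \<in> borel_measurable lebesgue" and le: "\<And>x. cmod (m x) \<le> C" and u: "u \<in> L2_space"
  shows "(\<lambda>x. m x * u x) \<in> L2_space"
proof (rule L2_space_cmod_le)
  show "(\<lambda>x. m x * u x) \<in> borel_measurable lebesgue"
    by (intro borel_measurable_times m L2_spaceD(1) u)
  show "cmod (m x * u x) \<le> C * cmod (u x)" for x
    by (simp add: norm_mult mult_right_mono le)
qed (rule u)

lemma L2_tendsto_mult:
  assumes m: "m \<in> borel_measurable lebesgue" and le: "\<And>x. cmod (m x) \<le> C"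
    and h: "\<And>n. h n \<in> L2_space" and f: "f \<in> L2_space" and hf: "L2_tendsto h f"
  shows "L2_tendsto (\<lambda>n x. m x * h n x) (\<lambda>x. m x * f x)"
proof -
  note mult = L2_space_mult[OF m le]
  have C: "C \<ge> 0" using le order_trans[OF norm_ge_zero] by blast
  have "(\<lambda>n. L2_norm (\<lambda>x. m x * h n x - m x * f x)) \<longlonglongrightarrow> 0"
  proof (rule Lim_null_comparison)
    show "\<forall>\<^sub>F n in sequentially. norm (L2_norm (\<lambda>x. m x * h n x - m x * f x)) \<le> C * L2_norm (\<lambda>x. h n x - f x)"
    proof (intro always_eventually allI)
      fix n
      have "(L2_norm (\<lambda>x. m x * h n x - m x * f x))\<^sup>2 \<le> (LINT x|lebesgue. C\<^sup>2 * (cmod (h n x - f x))\<^sup>2)"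
        unfolding L2_norm_power2
      proof (rule integral_mono)
        show "integrable lebesgue (\<lambda>x. (cmod (m x * h n x - m x * f x))\<^sup>2)"
          by (rule L2_spaceD(2)[OF L2_space_diff[OF mult[OF h] mult[OF f]]])
        show "integrable lebesgue (\<lambda>x. C\<^sup>2 * (cmod (h n x - f x))\<^sup>2)"
          by (intro integrable_mult_right L2_spaceD(2) L2_space_diff h f)
        show "(cmod (m x * h n x - m x * f x))\<^sup>2 \<le> C\<^sup>2 * (cmod (h n x - f x))\<^sup>2" for x
          using power_mono[OF le[of x], of 2]
          by (simp add: norm_mult power_mult_distrib mult_right_mono flip: right_diff_distrib)
      qed
      also have "\<dots> = (C * L2_norm (\<lambda>x. h n x - f x))\<^sup>2"
        by (simp add: power_mult_distrib L2_norm_power2)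
      finally have "L2_norm (\<lambda>x. m x * h n x - m x * f x) \<le> C * L2_norm (\<lambda>x. h n x - f x)"
        by (rule power2_le_imp_le) (use C in simp)
      then show "norm (L2_norm (\<lambda>x. m x * h n x - m x * f x)) \<le> C * L2_norm (\<lambda>x. h n x - f x)" by simp
    qed
    show "(\<lambda>n. C * L2_norm (\<lambda>x. h n x - f x)) \<longlonglongrightarrow> 0"
      using tendsto_mult_left[of "\<lambda>n. L2_norm (\<lambda>x. h n x - f x)" 0 sequentially C] hf
      by (simp add: L2_tendsto_iff[OF h f])
  qed
  then show ?thesis by (simp only: L2_tendsto_iff[OF mult[OF h] mult[OF f]])
qed

lemma L2_fourier_add_scale:
  assumes f: "f \<in> L2_space" and F: "is_L2_fourier f F"
    and g: "g \<in> L2_space" and G: "is_L2_fourier g G"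
  shows "is_L2_fourier (\<lambda>x. f x + c * g x) (\<lambda>x. F x + c * G x)"
proof -
  obtain h where h: "\<And>n::nat. h n \<in> L1_space \<inter> L2_space" and hf: "L2_tendsto h f"
    using L2_dense_L1[OF f] by blast
  obtain k where k: "\<And>n::nat. k n \<in> L1_space \<inter> L2_space" and kg: "L2_tendsto k g"
    using L2_dense_L1[OF g] by blast
  from h k have h2: "h n \<in> L2_space" and k2: "k n \<in> L2_space" for n by auto
  note Fh = Plancherel_L1_L2(1)[OF h] and Fk = Plancherel_L1_L2(1)[OF k]
  have F2: "F \<in> L2_space" and hF: "L2_tendsto (\<lambda>n. fourier (h n)) F"
    and G2: "G \<in> L2_space" and kG: "L2_tendsto (\<lambda>n. fourier (k n)) G"
    using F G h hf k kg by (auto simp: is_L2_fourier_def)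
  have sc: "L2_tendsto (\<lambda>n x. c * u n x) (\<lambda>x. c * v x)"
    if "\<And>n. u n \<in> L2_space" "v \<in> L2_space" "L2_tendsto u v" for u v
    by (rule L2_tendsto_mult[OF borel_measurable_const order_refl that])
  show ?thesis
  proof (rule is_L2_fourierI[OF _ _ L1_L2_add_scale[OF h k]])
    show "L2_tendsto (\<lambda>n x. h n x + c * k n x) (\<lambda>x. f x + c * g x)"
      by (rule L2_tendsto_add[OF h2 f hf L2_space_scale[OF k2] L2_space_scale[OF g] sc[OF k2 g kg]])
    have eq: "fourier (\<lambda>x. h n x + c * k n x) = (\<lambda>x. fourier (h n) x + c * fourier (k n) x)" for n
      using h[of n] k[of n] by (intro ext fourier_add_scale) (auto simp: L1_space_def)
    show "L2_tendsto (\<lambda>n. fourier (\<lambda>x. h n x + c * k n x)) (\<lambda>x. F x + c * G x)"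
      unfolding eq
      by (rule L2_tendsto_add[OF Fh F2 hF L2_space_scale[OF Fk] L2_space_scale[OF G2] sc[OF Fk G2 kG]])
  qed (auto intro!: L2_space_add L2_space_scale f g F2 G2)
qed

theorem L2_Parseval:
  fixes f g F G :: "'a :: euclidean_space \<Rightarrow> complex"
  assumes f: "f \<in> L2_space" and F: "is_L2_fourier f F"
    and g: "g \<in> L2_space" and G: "is_L2_fourier g G"
  shows "L2_inner F G = complex_of_real ((2 * pi) ^ DIM('a)) * L2_inner f g"
proof (rule L2_polarization[OF f g])
  show "F \<in> L2_space" "G \<in> L2_space" using F G by (auto simp: is_L2_fourier_def)
  show "(L2_norm F)\<^sup>2 = (2 * pi) ^ DIM('a) * (L2_norm f)\<^sup>2" by (rule L2_fourier_norm[OF f F])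
  show "(L2_norm G)\<^sup>2 = (2 * pi) ^ DIM('a) * (L2_norm g)\<^sup>2" by (rule L2_fourier_norm[OF g G])
  show "(L2_norm (\<lambda>x. F x + c * G x))\<^sup>2 = (2 * pi) ^ DIM('a) * (L2_norm (\<lambda>x. f x + c * g x))\<^sup>2" for c
    by (rule L2_fourier_norm[OF L2_space_add[OF f L2_space_scale[OF g]] L2_fourier_add_scale[OF f F g G]])
qed

lemma is_L2_fourier_cong_AE:
  assumes F: "is_L2_fourier f F" and G: "G \<in> borel_measurable lebesgue"
    and eq: "AE x in lebesgue. F x = G x"
  shows "is_L2_fourier f G"
proof -
  have F2: "F \<in> L2_space" using F by (auto simp: is_L2_fourier_def)
  have "(\<integral>\<^sup>+x. ennreal ((cmod (G x))\<^sup>2) \<partial>lebesgue) = (\<integral>\<^sup>+x. ennreal ((cmod (F x))\<^sup>2) \<partial>lebesgue)"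
    using eq by (intro nn_integral_cong_AE) auto
  then have "G \<in> L2_space" using F2 G by (simp add: L2_space_iff)
  moreover have "L2_tendsto h F \<longleftrightarrow> L2_tendsto h G" for h
  proof -
    have "(\<integral>\<^sup>+x. ennreal ((cmod (h n x - F x))\<^sup>2) \<partial>lebesgue)
        = (\<integral>\<^sup>+x. ennreal ((cmod (h n x - G x))\<^sup>2) \<partial>lebesgue)" for n
      using eq by (intro nn_integral_cong_AE) auto
    then show ?thesis by (simp add: L2_tendsto_def)
  qed
  ultimately show ?thesis using F by (simp add: is_L2_fourier_def)
qed

lemma L2_fourier_exists_borel:
  fixes f :: "'a :: euclidean_space \<Rightarrow> complex"
  assumes f: "f \<in> L2_space"
  obtains F where "is_L2_fourier f F" "F \<in> L2_space" "F \<in> borel_measurable borel"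
proof -
  obtain F where F: "is_L2_fourier f F" using L2_fourier_exists[OF f] .
  then have "F \<in> borel_measurable lebesgue" by (auto simp: is_L2_fourier_def L2_space_def)
  then obtain G where G: "G \<in> borel_measurable borel" "AE x in lebesgue. F x = G x"
    using lebesgue_ex_borel by blast
  have "is_L2_fourier f G"
    by (rule is_L2_fourier_cong_AE[OF F measurable_lborel_imp_lebesgue[OF G(1)] G(2)])
  then show thesis using G(1) that by (auto simp: is_L2_fourier_def)
qed

definition coord_inv :: "'a :: euclidean_space \<Rightarrow> 'a" where
  "coord_inv a = (\<Sum>j\<in>Basis. (1 / (a \<bullet> j)) *\<^sub>R j)"

lemma coord_inv_inner: "j \<in> Basis \<Longrightarrow> coord_inv a \<bullet> j = 1 / (a \<bullet> j)"
  by (simp add: coord_inv_def)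

text \<open>Dilating the variable by \<open>a\<close> is therefore dilating the frequency by \<open>a\<close>.\<close>

lemma coord_scale_adjoint: "coord_scale a x \<bullet> y = x \<bullet> coord_scale a y"
  by (subst (1 2) euclidean_inner) (simp add: coord_scale_inner mult_ac)

lemma coord_scale_diff: "coord_scale a (x - y) = - coord_scale a y + coord_scale a x"
  by (rule euclidean_eqI) (simp add: coord_scale_inner inner_diff_left inner_add_left algebra_simps)

lemma coord_scale_inv:
  assumes "coord_prod a \<noteq> 0"
  shows "coord_scale (coord_inv a) (coord_scale a x) = x"
  by (rule euclidean_eqI) (simp add: coord_scale_inner coord_inv_inner coord_nz[OF assms])

lemma coord_prod_inv: "coord_prod (coord_inv a) = 1 / coord_prod a"
  by (simp add: coord_prod_def coord_inv_inner prod_dividef)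

lemma coord_prod_nonneg [simp]: "coord_prod a \<ge> 0"
  by (simp add: coord_prod_def prod_nonneg)

text \<open>The substitution \<open>t = b + a x\<close>.\<close>

lemma fourier_dilation:
  fixes h :: "'a :: euclidean_space \<Rightarrow> complex"
  assumes a: "coord_prod a \<noteq> 0" and h: "h \<in> borel_measurable lebesgue"
  shows "fourier (\<lambda>t. h (coord_scale (coord_inv a) (t - b))) \<eta>
    = of_real (coord_prod a) * cis (- (b \<bullet> \<eta>)) * fourier h (coord_scale a \<eta>)"
proof -
  have ia: "coord_prod (coord_inv a) \<noteq> 0" using a by (simp add: coord_prod_inv)
  let ?k = "\<lambda>t. h (coord_scale (coord_inv a) (t - b)) * cis (- (t \<bullet> \<eta>))"
  have "(\<lambda>t. h (coord_scale (coord_inv a) (t - b))) \<in> borel_measurable lebesgue"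
    unfolding coord_scale_diff by (rule measurable_compose_affine[OF ia h])
  then have km: "?k \<in> borel_measurable lebesgue" by (intro borel_measurable_times cis_inner_lebesgue)
  have "(LINT t|lebesgue. ?k t) = of_real (coord_prod a) * (LINT x|lebesgue. ?k (b + coord_scale a x))"
    by (rule integral_affine[OF a km])
  also have "(LINT x|lebesgue. ?k (b + coord_scale a x))
      = (LINT x|lebesgue. cis (- (b \<bullet> \<eta>)) * (h x * cis (- (x \<bullet> coord_scale a \<eta>))))"
  proof (intro Bochner_Integration.integral_cong refl)
    fix x
    have "cis (- ((b + coord_scale a x) \<bullet> \<eta>)) = cis (- (b \<bullet> \<eta>)) * cis (- (x \<bullet> coord_scale a \<eta>))"
      by (simp add: cis_mult inner_add_left coord_scale_adjoint)
    then show "?k (b + coord_scale a x) = cis (- (b \<bullet> \<eta>)) * (h x * cis (- (x \<bullet> coord_scale a \<eta>)))"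
      by (simp add: coord_scale_inv[OF a])
  qed
  finally show ?thesis by (simp add: fourier_def)
qed

lemma L2_fourier_dilation:
  fixes f F :: "'a :: euclidean_space \<Rightarrow> complex"
  assumes a: "coord_prod a \<noteq> 0" and f: "f \<in> L2_space" and F: "is_L2_fourier f F"
  shows "(\<lambda>t. f (coord_scale (coord_inv a) (t - b))) \<in> L2_space"
    and "is_L2_fourier (\<lambda>t. f (coord_scale (coord_inv a) (t - b)))
      (\<lambda>\<eta>. of_real (coord_prod a) * cis (- (b \<bullet> \<eta>)) * F (coord_scale a \<eta>))"
proof -
  have ia: "coord_prod (coord_inv a) \<noteq> 0" using a by (simp add: coord_prod_inv)
  show f': "(\<lambda>t. f (coord_scale (coord_inv a) (t - b))) \<in> L2_space"
    unfolding coord_scale_diff by (rule L2_space_affine[OF ia f])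
  obtain h where h: "\<And>n::nat. h n \<in> L1_space \<inter> L2_space" and hf: "L2_tendsto h f"
    using L2_dense_L1[OF f] by blast
  from h have h1: "integrable lebesgue (h n)" and h2: "h n \<in> L2_space" for n
    by (auto simp: L1_space_def)
  note Fh = Plancherel_L1_L2(1)[OF h]
  have F2: "F \<in> L2_space" and hF: "L2_tendsto (\<lambda>n. fourier (h n)) F"
    using F h hf by (auto simp: is_L2_fourier_def)
  let ?m = "\<lambda>\<eta>. of_real (coord_prod a) * cis (- (b \<bullet> \<eta>))"
  have m: "?m \<in> borel_measurable lebesgue"
    by (rule measurable_lborel_imp_lebesgue) measurable
  have m_le: "cmod (?m \<eta>) \<le> coord_prod a" for \<eta> by (simp add: norm_mult)
  have sc: "(\<lambda>x. u (coord_scale a x)) \<in> L2_space" if "u \<in> L2_space" for u :: "'a \<Rightarrow> complex"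
    using L2_space_affine[OF a that, of 0] by simp
  note mult = L2_space_mult[OF m m_le]
  show "is_L2_fourier (\<lambda>t. f (coord_scale (coord_inv a) (t - b))) (\<lambda>\<eta>. ?m \<eta> * F (coord_scale a \<eta>))"
  proof (rule is_L2_fourierI[OF f' mult[OF sc[OF F2]]])
    show "(\<lambda>t. h n (coord_scale (coord_inv a) (t - b))) \<in> L1_space \<inter> L2_space" for n
      unfolding coord_scale_diff L1_space_def
      by (intro IntI CollectI integrable_affine[OF ia h1] L2_space_affine[OF ia h2])
    show "L2_tendsto (\<lambda>n t. h n (coord_scale (coord_inv a) (t - b))) (\<lambda>t. f (coord_scale (coord_inv a) (t - b)))"
      unfolding coord_scale_diff by (rule L2_tendsto_affine[OF ia h2 f hf])
    have eq: "fourier (\<lambda>t. h n (coord_scale (coord_inv a) (t - b)))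
        = (\<lambda>\<eta>. ?m \<eta> * fourier (h n) (coord_scale a \<eta>))" for n
      by (intro ext fourier_dilation[OF a L2_spaceD(1)[OF h2]])
    have "L2_tendsto (\<lambda>n x. fourier (h n) (coord_scale a x)) (\<lambda>x. F (coord_scale a x))"
      using L2_tendsto_affine[OF a Fh F2 hF, of 0] by simp
    then show "L2_tendsto (\<lambda>n. fourier (\<lambda>t. h n (coord_scale (coord_inv a) (t - b))))
        (\<lambda>\<eta>. ?m \<eta> * F (coord_scale a \<eta>))"
      unfolding eq by (intro L2_tendsto_mult[OF m m_le] sc Fh F2)
  qed
qed

section \<open>The wavelet transform with coordinatewise dilations\<close>

definition cwt :: "('a :: euclidean_space \<Rightarrow> complex) \<Rightarrow> ('a \<Rightarrow> complex) \<Rightarrow> 'a \<Rightarrow> 'a \<Rightarrow> complex" where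
  "cwt f \<phi> a b = L2_inner f (\<lambda>t. \<phi> (coord_scale (coord_inv a) (t - b)))"

lemma coord_scale_commute: "coord_scale a x = coord_scale x a"
  by (simp add: coord_scale_def mult.commute)

lemma coord_prod_scale: "coord_prod (coord_scale a x) = coord_prod a * coord_prod x"
  by (simp add: coord_prod_def coord_scale_inner abs_mult prod.distrib)

lemma measurable_coord_scale [measurable]:
  assumes "f \<in> borel_measurable M" "g \<in> borel_measurable M"
  shows "(\<lambda>x. coord_scale (f x) (g x)) \<in> borel_measurable M"
  using assms unfolding coord_scale_def by measurable

lemma measurable_coord_prod [measurable]: "coord_prod \<in> borel_measurable borel"
  unfolding coord_prod_def by measurable

lemma AE_coord_prod_nz: "AE x :: 'a :: euclidean_space in lborel. coord_prod x \<noteq> 0"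
proof -
  have "AE x :: 'a in lborel. x \<bullet> j \<noteq> 0" if "j \<in> Basis" for j :: 'a
  proof -
    have "{x. x \<bullet> j = 0} \<in> null_sets lebesgue"
      using negligible_standard_hyperplane[OF that, of 0] by (simp only: negligible_iff_null_sets)
    then have "AE x in lebesgue. x \<notin> {x. x \<bullet> j = 0}" by (rule AE_not_in)
    then show ?thesis by (simp add: AE_completion_iff)
  qed
  then have "AE x :: 'a in lborel. \<forall>j\<in>Basis. x \<bullet> j \<noteq> 0"
    by (intro AE_finite_allI) auto
  then show ?thesis by eventually_elim (simp add: coord_prod_def)
qed

text \<open>The measure \<open>du / coord_prod u\<close> is a Haar measure of the group of coordinatewise dilations. Where
  \<open>coord_prod\<close> vanishes the integrand is 0 by the convention for division by 0, so these are integrals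
  over the group.\<close>

lemma nn_integral_dilation_invariant:
  fixes \<Phi> :: "'a :: euclidean_space \<Rightarrow> complex"
  assumes \<Phi>: "\<Phi> \<in> borel_measurable lebesgue" and d: "coord_prod d \<noteq> 0"
  shows "(\<integral>\<^sup>+u. ennreal ((cmod (\<Phi> (coord_scale d u)))\<^sup>2 / coord_prod u) \<partial>lebesgue)
    = (\<integral>\<^sup>+u. ennreal ((cmod (\<Phi> u))\<^sup>2 / coord_prod u) \<partial>lebesgue)"
proof -
  have [measurable]: "(coord_prod :: 'a \<Rightarrow> real) \<in> borel_measurable lebesgue"
    by (rule measurable_lborel_imp_lebesgue) measurable
  note [measurable] = \<Phi>
  have meas: "(\<lambda>u. ennreal ((cmod (\<Phi> u))\<^sup>2 / coord_prod u)) \<in> borel_measurable lebesgue" by measurable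
  have meas_d: "(\<lambda>u. ennreal ((cmod (\<Phi> (coord_scale d u)))\<^sup>2 / coord_prod (coord_scale d u))) \<in> borel_measurable lebesgue"
    using measurable_compose_affine[OF d meas, of 0] by simp
  have "(\<integral>\<^sup>+u. ennreal ((cmod (\<Phi> u))\<^sup>2 / coord_prod u) \<partial>lebesgue)
      = ennreal (coord_prod d) * (\<integral>\<^sup>+u. ennreal ((cmod (\<Phi> (coord_scale d u)))\<^sup>2 / coord_prod (coord_scale d u)) \<partial>lebesgue)"
    using nn_integral_affine[OF d meas, of 0] by simp
  also have "\<dots> = (\<integral>\<^sup>+u. ennreal (coord_prod d) * ennreal ((cmod (\<Phi> (coord_scale d u)))\<^sup>2 / coord_prod (coord_scale d u)) \<partial>lebesgue)"
    by (rule nn_integral_cmult[OF meas_d, symmetric])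
  also have "\<dots> = (\<integral>\<^sup>+u. ennreal ((cmod (\<Phi> (coord_scale d u)))\<^sup>2 / coord_prod u) \<partial>lebesgue)"
    using d by (intro nn_integral_cong) (simp add: coord_prod_scale flip: ennreal_mult)
  finally show ?thesis ..
qed

text \<open>Parseval's formula, with the transform of the translated and dilated wavelet from
  \<open>L2_fourier_dilation\<close>. The right-hand side is an absolutely convergent integral, whence also the
  joint measurability in \<open>(a, b)\<close> used below.\<close>

lemma cwt_eq_fourier:
  fixes f \<phi> F \<Phi> :: "'a :: euclidean_space \<Rightarrow> complex"
  assumes f: "f \<in> L2_space" and F: "is_L2_fourier f F"
    and \<phi>: "\<phi> \<in> L2_space" and \<Phi>: "is_L2_fourier \<phi> \<Phi>" and a: "coord_prod a \<noteq> 0"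
  shows "cwt f \<phi> a b = complex_of_real (coord_prod a / (2 * pi) ^ DIM('a)) *
    fourier (\<lambda>\<eta>. F \<eta> * cnj (\<Phi> (coord_scale a \<eta>))) (- b)"
proof -
  note D = L2_fourier_dilation[OF a \<phi> \<Phi>, of b]
  have "complex_of_real ((2 * pi) ^ DIM('a)) * cwt f \<phi> a b
      = L2_inner F (\<lambda>\<eta>. of_real (coord_prod a) * cis (- (b \<bullet> \<eta>)) * \<Phi> (coord_scale a \<eta>))"
    unfolding cwt_def by (rule L2_Parseval[OF f F D, symmetric])
  also have "\<dots> = (LINT \<eta>|lebesgue. of_real (coord_prod a) * (F \<eta> * cnj (\<Phi> (coord_scale a \<eta>)) * cis (- (\<eta> \<bullet> - b))))"
    unfolding L2_inner_def
    by (intro Bochner_Integration.integral_cong) (auto simp: cis_cnj inner_commute)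
  also have "\<dots> = of_real (coord_prod a) * fourier (\<lambda>\<eta>. F \<eta> * cnj (\<Phi> (coord_scale a \<eta>))) (- b)"
    unfolding fourier_def by (rule integral_mult_right_zero)
  finally show ?thesis by (simp add: field_simps)
qed

lemma nn_integral_cwt:
  fixes f \<phi> F \<Phi> :: "'a :: euclidean_space \<Rightarrow> complex"
  assumes f: "f \<in> L2_space" and F: "is_L2_fourier f F"
    and \<phi>: "\<phi> \<in> L2_space" and \<Phi>: "is_L2_fourier \<phi> \<Phi>" and a: "coord_prod a \<noteq> 0"
    and H: "(\<lambda>\<eta>. F \<eta> * cnj (\<Phi> (coord_scale a \<eta>))) \<in> L2_space"
  shows "(\<integral>\<^sup>+b. ennreal ((cmod (cwt f \<phi> a b))\<^sup>2) \<partial>lebesgue)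
    = ennreal ((coord_prod a)\<^sup>2 / (2 * pi) ^ DIM('a)) *
      (\<integral>\<^sup>+\<eta>. ennreal ((cmod (F \<eta> * cnj (\<Phi> (coord_scale a \<eta>))))\<^sup>2) \<partial>lebesgue)"
proof -
  let ?H = "\<lambda>\<eta>. F \<eta> * cnj (\<Phi> (coord_scale a \<eta>))"
  let ?P = "(2 * pi) ^ DIM('a) :: real"
  have F2: "F \<in> L2_space" and \<Phi>2: "\<Phi> \<in> L2_space" using F \<Phi> by (auto simp: is_L2_fourier_def)
  have "(\<lambda>\<eta>. \<Phi> (coord_scale a \<eta>)) \<in> L2_space"
    using L2_space_affine[OF a \<Phi>2, of 0] by simp
  from L2_mult_integrable[OF F2 this] H have H12: "?H \<in> L1_space \<inter> L2_space"
    by (simp add: L1_space_def)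
  have FH: "fourier ?H \<in> L2_space" by (rule Plancherel_L1_L2(1)[OF H12])
  have neg: "coord_prod ((-1) *\<^sub>R One :: 'a) \<noteq> 0" by (subst coord_prod_One) simp
  have refl: "(\<lambda>b. fourier ?H (- b)) \<in> L2_space" "L2_norm (\<lambda>b. fourier ?H (- b)) = L2_norm (fourier ?H)"
    using L2_space_affine[OF neg FH, of 0] L2_norm_affine[OF neg FH, of 0]
    by (simp_all only: coord_scale_One coord_prod_One) simp_all
  have "(\<integral>\<^sup>+b. ennreal ((cmod (cwt f \<phi> a b))\<^sup>2) \<partial>lebesgue)
      = (\<integral>\<^sup>+b. ennreal ((coord_prod a / ?P)\<^sup>2) * ennreal ((cmod (fourier ?H (- b)))\<^sup>2) \<partial>lebesgue)"
    unfolding cwt_eq_fourier[OF f F \<phi> \<Phi> a] norm_mult norm_of_real power_mult_distrib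
    by (simp add: ennreal_mult)
  also have "\<dots> = ennreal ((coord_prod a / ?P)\<^sup>2) * (\<integral>\<^sup>+b. ennreal ((cmod (fourier ?H (- b)))\<^sup>2) \<partial>lebesgue)"
  proof (rule nn_integral_cmult)
    have "(\<lambda>z :: complex. ennreal ((cmod z)\<^sup>2)) \<in> borel_measurable borel" by measurable
    from measurable_compose[OF L2_spaceD(1)[OF refl(1)] this]
    show "(\<lambda>b. ennreal ((cmod (fourier ?H (- b)))\<^sup>2)) \<in> borel_measurable lebesgue" .
  qed
  also have "\<dots> = ennreal ((coord_prod a / ?P)\<^sup>2) * ennreal (?P * (L2_norm ?H)\<^sup>2)"
    unfolding nn_integral_L2_norm[OF refl(1)] refl(2) Plancherel_L1_L2(2)[OF H12] ..
  also have "\<dots> = ennreal ((coord_prod a)\<^sup>2 / ?P) * ennreal ((L2_norm ?H)\<^sup>2)"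
    by (simp add: power2_eq_square flip: ennreal_mult)
  finally show ?thesis unfolding nn_integral_L2_norm[OF H] .
qed

text \<open>The wavelet transform normalized so that Lebesgue measure on the product space gives the
  orthogonality relation. In the fractional setting a factor \<open>1 / sqrt |a|\<close> belongs to the daughter wavelet
  and a factor \<open>1 / |a|\<close> is the square root of the density; together they make \<open>1 / sqrt (|a| ^ 3)\<close>. The value is
  0 at degenerate scales.\<close>

definition cwt_density ::
    "('a :: euclidean_space \<Rightarrow> complex) \<Rightarrow> ('a \<Rightarrow> complex) \<Rightarrow> 'a \<times> 'a \<Rightarrow> complex" where
  "cwt_density \<phi> f p = cwt f \<phi> (fst p) (snd p) / complex_of_real (sqrt (coord_prod (fst p) ^ 3))"

text \<open>For almost every \<open>a\<close>, the function \<open>G\<close> of the proof is up to a constant the energy at scale \<open>a\<close>. Its integral is computed by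
  Tonelli's theorem first, integrating over the scale for fixed frequency, where
  \<open>nn_integral_dilation_invariant\<close> gives \<open>\<kappa>\<close>. Being finite, the integral shows that \<open>H a\<close> is square
  integrable for almost every \<open>a\<close>, and only for those is Plancherel's formula \<open>nn_integral_cwt\<close> applied.\<close>

lemma cwt_density_isometry:
  fixes f \<phi> \<Phi> :: "'a :: euclidean_space \<Rightarrow> complex"
  assumes f: "f \<in> L2_space" and \<phi>: "\<phi> \<in> L2_space"
    and \<Phi>: "is_L2_fourier \<phi> \<Phi>" and \<Phi>m [measurable]: "\<Phi> \<in> borel_measurable borel"
    and \<kappa>: "(\<integral>\<^sup>+u. ennreal ((cmod (\<Phi> u))\<^sup>2 / coord_prod u) \<partial>lebesgue) = ennreal \<kappa>" "\<kappa> \<ge> 0"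
  shows "cwt_density \<phi> f \<in> L2_space" "(L2_norm (cwt_density \<phi> f))\<^sup>2 = \<kappa> * (L2_norm f)\<^sup>2"
proof -
  let ?P = "(2 * pi) ^ DIM('a) :: real"
  have P: "?P > 0" by simp
  obtain F where F: "is_L2_fourier f F" and F2: "F \<in> L2_space" and Fm [measurable]: "F \<in> borel_measurable borel"
    using L2_fourier_exists_borel[OF f] .
  define H where "H a \<eta> = F \<eta> * cnj (\<Phi> (coord_scale a \<eta>))" for a \<eta>
  have Hm [measurable]: "(\<lambda>p. H (fst p) (snd p)) \<in> borel_measurable (borel \<Otimes>\<^sub>M borel)"
    unfolding H_def by measurable
  have Ha [measurable]: "H a \<in> borel_measurable borel" for a
    unfolding H_def by measurable
  have U_eq: "cwt_density \<phi> f p = complex_of_real (coord_prod (fst p) / ?P) *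
      (LINT \<eta>|lborel. H (fst p) \<eta> * cis (- (\<eta> \<bullet> - snd p))) / complex_of_real (sqrt (coord_prod (fst p) ^ 3))" for p
  proof (cases "coord_prod (fst p) = 0")
    case False
    have "fourier (H (fst p)) (- snd p) = (LINT \<eta>|lborel. H (fst p) \<eta> * cis (- (\<eta> \<bullet> - snd p)))"
      by (rule fourier_eq_lborel[OF Ha])
    then show ?thesis
      unfolding cwt_density_def cwt_eq_fourier[OF f F \<phi> \<Phi> False] H_def[symmetric, abs_def] by simp
  qed (simp add: cwt_density_def)
  have Hm' [measurable]: "(\<lambda>x. H (fst (fst x)) (snd x)) \<in> borel_measurable ((borel \<Otimes>\<^sub>M borel) \<Otimes>\<^sub>M lborel)"
    unfolding H_def by measurable
  have "(\<lambda>p. LINT \<eta>|lborel. H (fst p) \<eta> * cis (- (\<eta> \<bullet> - snd p))) \<in> borel_measurable (borel \<Otimes>\<^sub>M borel)"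
    by (rule lborel.borel_measurable_lebesgue_integral) (simp add: split_beta', measurable)
  then have Um: "cwt_density \<phi> f \<in> borel_measurable (borel \<Otimes>\<^sub>M borel)"
    unfolding U_eq[abs_def] by measurable
  then have UmL: "cwt_density \<phi> f \<in> borel_measurable lebesgue"
    by (intro measurable_lborel_imp_lebesgue) (simp only: borel_prod)
  define G where "G a = (\<integral>\<^sup>+\<eta>. ennreal ((cmod (H a \<eta>))\<^sup>2 / coord_prod a) \<partial>lborel)" for a
  have "(\<integral>\<^sup>+a. G a \<partial>lborel) = (\<integral>\<^sup>+\<eta>. \<integral>\<^sup>+a. ennreal ((cmod (H a \<eta>))\<^sup>2 / coord_prod a) \<partial>lborel \<partial>lborel)"
    unfolding G_def H_def by (rule lborel_pair.Fubini') measurable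
  also have "\<dots> = (\<integral>\<^sup>+\<eta>. ennreal \<kappa> * ennreal ((cmod (F \<eta>))\<^sup>2) \<partial>lborel)"
  proof (rule nn_integral_cong_AE)
    show "AE \<eta> in lborel. (\<integral>\<^sup>+a. ennreal ((cmod (H a \<eta>))\<^sup>2 / coord_prod a) \<partial>lborel)
        = ennreal \<kappa> * ennreal ((cmod (F \<eta>))\<^sup>2)"
      using AE_coord_prod_nz
    proof eventually_elim
      case (elim \<eta>)
      have "(\<integral>\<^sup>+a. ennreal ((cmod (H a \<eta>))\<^sup>2 / coord_prod a) \<partial>lborel)
          = (\<integral>\<^sup>+a. ennreal ((cmod (F \<eta>))\<^sup>2) * ennreal ((cmod (\<Phi> (coord_scale \<eta> a)))\<^sup>2 / coord_prod a) \<partial>lborel)"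
        unfolding H_def coord_scale_commute[of _ \<eta>]
        by (intro nn_integral_cong) (simp add: norm_mult power_mult_distrib flip: ennreal_mult)
      also have "\<dots> = ennreal ((cmod (F \<eta>))\<^sup>2) * (\<integral>\<^sup>+a. ennreal ((cmod (\<Phi> (coord_scale \<eta> a)))\<^sup>2 / coord_prod a) \<partial>lborel)"
        by (rule nn_integral_cmult) measurable
      also have "(\<integral>\<^sup>+a. ennreal ((cmod (\<Phi> (coord_scale \<eta> a)))\<^sup>2 / coord_prod a) \<partial>lborel) = ennreal \<kappa>"
        using nn_integral_dilation_invariant[OF measurable_lborel_imp_lebesgue[OF \<Phi>m] elim] \<kappa>
        by (simp only: nn_integral_completion)
      finally show ?case by (simp add: mult.commute)
    qed
  qed
  also have "\<dots> = ennreal \<kappa> * (\<integral>\<^sup>+\<eta>. ennreal ((cmod (F \<eta>))\<^sup>2) \<partial>lborel)"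
    by (rule nn_integral_cmult) measurable
  also have "\<dots> = ennreal \<kappa> * ennreal (?P * (L2_norm f)\<^sup>2)"
    using nn_integral_L2_norm[OF F2] L2_fourier_norm[OF f F] by (simp only: nn_integral_completion)
  finally have G_int: "(\<integral>\<^sup>+a. G a \<partial>lborel) = ennreal (\<kappa> * (?P * (L2_norm f)\<^sup>2))"
    using \<kappa>(2) by (simp add: ennreal_mult)
  have Gm [measurable]: "G \<in> borel_measurable borel"
    unfolding G_def H_def by measurable
  have G_fin: "AE a in lborel. G a \<noteq> \<infinity>"
    by (rule nn_integral_PInf_AE) (use Gm G_int in auto)
  have inner: "AE a in lborel. (\<integral>\<^sup>+b. ennreal ((cmod (cwt_density \<phi> f (a, b)))\<^sup>2) \<partial>lborel) = ennreal (1 / ?P) * G a"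
    using G_fin AE_coord_prod_nz
  proof eventually_elim
    case (elim a)
    let ?p = "coord_prod a"
    have p: "?p > 0" using elim(2) coord_prod_nonneg[of a] by linarith
    have GH: "G a = ennreal (1 / ?p) * (\<integral>\<^sup>+\<eta>. ennreal ((cmod (H a \<eta>))\<^sup>2) \<partial>lborel)"
      unfolding G_def using p
      by (subst nn_integral_cmult[symmetric]) (simp_all flip: ennreal_mult)
    have "(\<integral>\<^sup>+\<eta>. ennreal ((cmod (H a \<eta>))\<^sup>2) \<partial>lborel) < \<infinity>"
      using elim(1) p unfolding GH by (auto simp: ennreal_mult_eq_top_iff less_top)
    then have "H a \<in> L2_space"
      unfolding L2_space_iff nn_integral_completion
      using measurable_lborel_imp_lebesgue[OF Ha] by simp
    then have cw: "(\<integral>\<^sup>+b. ennreal ((cmod (cwt f \<phi> a b))\<^sup>2) \<partial>lborel)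
        = ennreal (?p\<^sup>2 / ?P) * (\<integral>\<^sup>+\<eta>. ennreal ((cmod (H a \<eta>))\<^sup>2) \<partial>lborel)"
      using nn_integral_cwt[OF f F \<phi> \<Phi> elim(2)] unfolding H_def nn_integral_completion by simp
    have cwm: "(\<lambda>b. ennreal ((cmod (cwt f \<phi> a b))\<^sup>2)) \<in> borel_measurable lborel"
    proof -
      have "(\<lambda>b. fourier (H a) (- b)) \<in> borel_measurable borel"
        using fourier_measurable_borel[OF Ha, of a] by measurable
      then show ?thesis
        unfolding cwt_eq_fourier[OF f F \<phi> \<Phi> elim(2)] H_def[symmetric] by measurable
    qed
    have "(\<integral>\<^sup>+b. ennreal ((cmod (cwt_density \<phi> f (a, b)))\<^sup>2) \<partial>lborel)
        = (\<integral>\<^sup>+b. ennreal (1 / ?p ^ 3) * ennreal ((cmod (cwt f \<phi> a b))\<^sup>2) \<partial>lborel)"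
      using p by (intro nn_integral_cong)
        (simp add: cwt_density_def norm_divide power_divide flip: ennreal_mult)
    also have "\<dots> = ennreal (1 / ?p ^ 3) * (ennreal (?p\<^sup>2 / ?P) * (\<integral>\<^sup>+\<eta>. ennreal ((cmod (H a \<eta>))\<^sup>2) \<partial>lborel))"
      unfolding nn_integral_cmult[OF cwm] cw ..
    also have "\<dots> = ennreal (1 / ?P) * G a"
      unfolding GH mult.assoc[symmetric] using p
      by (simp add: power2_eq_square power3_eq_cube mult_ac flip: ennreal_mult)
    finally show ?case .
  qed
  have "(\<integral>\<^sup>+p. ennreal ((cmod (cwt_density \<phi> f p))\<^sup>2) \<partial>lebesgue)
      = (\<integral>\<^sup>+p. ennreal ((cmod (cwt_density \<phi> f p))\<^sup>2) \<partial>(lborel \<Otimes>\<^sub>M lborel))"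
    by (simp only: nn_integral_completion lborel_prod)
  also have "\<dots> = (\<integral>\<^sup>+a. \<integral>\<^sup>+b. ennreal ((cmod (cwt_density \<phi> f (a, b)))\<^sup>2) \<partial>lborel \<partial>lborel)"
    using Um by (intro lborel.nn_integral_fst[symmetric]) measurable
  also have "\<dots> = (\<integral>\<^sup>+a. ennreal (1 / ?P) * G a \<partial>lborel)"
    by (rule nn_integral_cong_AE[OF inner])
  also have "\<dots> = ennreal (1 / ?P) * ennreal (\<kappa> * (?P * (L2_norm f)\<^sup>2))"
    unfolding G_int[symmetric] by (rule nn_integral_cmult) simp
  also have "\<dots> = ennreal (\<kappa> * (L2_norm f)\<^sup>2)"
    using P \<kappa>(2) by (subst ennreal_mult[symmetric]) auto
  finally have *: "(\<integral>\<^sup>+p. ennreal ((cmod (cwt_density \<phi> f p))\<^sup>2) \<partial>lebesgue) = ennreal (\<kappa> * (L2_norm f)\<^sup>2)" .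
  have nn: "\<kappa> * (L2_norm f)\<^sup>2 \<ge> 0" using \<kappa>(2) by simp
  show "cwt_density \<phi> f \<in> L2_space" "(L2_norm (cwt_density \<phi> f))\<^sup>2 = \<kappa> * (L2_norm f)\<^sup>2"
    by (rule L2_norm_eqI[OF UmL * nn])+
qed

theorem cwt_density_Parseval:
  fixes f g \<phi> \<Phi> :: "'a :: euclidean_space \<Rightarrow> complex"
  assumes f: "f \<in> L2_space" and g: "g \<in> L2_space" and \<phi>: "\<phi> \<in> L2_space"
    and \<Phi>: "is_L2_fourier \<phi> \<Phi>" and \<Phi>m: "\<Phi> \<in> borel_measurable borel"
    and \<kappa>: "(\<integral>\<^sup>+u. ennreal ((cmod (\<Phi> u))\<^sup>2 / coord_prod u) \<partial>lebesgue) = ennreal \<kappa>" "\<kappa> \<ge> 0"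
  shows "L2_inner (cwt_density \<phi> f) (cwt_density \<phi> g) = complex_of_real \<kappa> * L2_inner f g"
proof (rule L2_polarization[OF f g])
  note iso = cwt_density_isometry[OF _ \<phi> \<Phi> \<Phi>m \<kappa>]
  show "cwt_density \<phi> f \<in> L2_space" "cwt_density \<phi> g \<in> L2_space" by (rule iso(1)[OF f], rule iso(1)[OF g])
  show "(L2_norm (cwt_density \<phi> f))\<^sup>2 = \<kappa> * (L2_norm f)\<^sup>2"
    "(L2_norm (cwt_density \<phi> g))\<^sup>2 = \<kappa> * (L2_norm g)\<^sup>2" by (rule iso(2)[OF f], rule iso(2)[OF g])
  fix c
  have "cwt_density \<phi> (\<lambda>x. f x + c * g x) p = cwt_density \<phi> f p + c * cwt_density \<phi> g p" for p
  proof (cases "coord_prod (fst p) = 0")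
    case False
    have d: "(\<lambda>t. \<phi> (coord_scale (coord_inv (fst p)) (t - snd p))) \<in> L2_space"
      by (rule L2_fourier_dilation(1)[OF False \<phi> \<Phi>])
    show ?thesis
      unfolding cwt_density_def cwt_def L2_inner_add_left[OF f g d] by (simp add: add_divide_distrib)
  qed (simp add: cwt_density_def)
  then have "(\<lambda>p. cwt_density \<phi> f p + c * cwt_density \<phi> g p) = cwt_density \<phi> (\<lambda>x. f x + c * g x)" by auto
  then show "(L2_norm (\<lambda>p. cwt_density \<phi> f p + c * cwt_density \<phi> g p))\<^sup>2 = \<kappa> * (L2_norm (\<lambda>x. f x + c * g x))\<^sup>2"
    using iso(2)[OF L2_space_add[OF f L2_space_scale[OF g]]] by simp
qed

section \<open>Reduction of the fractional transforms\<close>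

lemma coord_prod_vec: "coord_prod a = mod_prod (a :: real ^ 'n)"
proof -
  have B: "(Basis :: (real ^ 'n) set) = range (\<lambda>k. axis k 1)"
    by (auto simp: Basis_vec_def)
  have "inj (\<lambda>k. axis k (1::real) :: real ^ 'n)"
    by (auto simp: inj_on_def axis_eq_axis)
  then have "coord_prod a = (\<Prod>k\<in>UNIV. \<bar>a $ k\<bar>)"
    unfolding coord_prod_def B by (simp add: prod.reindex inner_axis)
  then show ?thesis by (simp add: mod_prod_def abs_prod)
qed

lemma coord_scale_vec: "coord_scale a x $ k = a $ k * (x :: real ^ 'n) $ k"
  using coord_scale_inner[of "axis k 1" a x] by (simp add: axis_in_Basis_iff inner_axis)

lemma coord_inv_vec: "coord_inv a $ k = 1 / (a :: real ^ 'n) $ k"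
  using coord_inv_inner[of "axis k 1" a] by (simp add: axis_in_Basis_iff inner_axis)

lemma cmod_chirp [simp]: "cmod (chirp \<alpha> \<mu> x) = 1"
  by (simp add: chirp_def)

lemma cnj_chirp: "cnj (chirp \<alpha> \<mu> x) = chirp \<alpha> (- \<mu>) x"
  by (simp add: chirp_def exp_cnj)

lemma chirp_mult_cnj [simp]: "chirp \<alpha> \<mu> x * cnj (chirp \<alpha> \<mu> x) = 1"
  by (simp add: complex_norm_square[symmetric])

lemma chirp_measurable: "chirp \<alpha> \<mu> \<in> borel_measurable lebesgue"
  by (rule measurable_lborel_imp_lebesgue) (unfold chirp_def, measurable)

text \<open>Each factor is the square root of a number with real part 1.\<close>

lemma cprod_nonzero: "cprod \<alpha> \<noteq> 0"
proof -
  have "1 - \<i> * complex_of_real t \<noteq> 0" for t by (simp add: complex_eq_iff)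
  then show ?thesis by (simp add: cprod_def ccoef_def)
qed

text \<open>The factor between the fractional frequency and the ordinary one.\<close>

definition csc_scale :: "real ^ 'n \<Rightarrow> real \<Rightarrow> real ^ 'n" where
  "csc_scale \<alpha> lam = (\<chi> k. lam\<^sup>2 / sin (\<alpha> $ k))"

lemma mfrft_integral_eq_fourier:
  fixes \<alpha> :: "real ^ 'n"
  shows "mfrft_integral \<alpha> lam h \<xi> = cprod \<alpha> / complex_of_real (sqrt (2 * pi) ^ CARD('n))
    * chirp \<alpha> (lam\<^sup>2) \<xi> * fourier (\<lambda>x. chirp \<alpha> (lam\<^sup>2) x * h x) (coord_scale (csc_scale \<alpha> lam) \<xi>)"
proof -
  let ?c = "cprod \<alpha> / complex_of_real (sqrt (2 * pi) ^ CARD('n)) * chirp \<alpha> (lam\<^sup>2) \<xi>"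
  have inner: "lam\<^sup>2 * (\<Sum>k\<in>UNIV. x $ k * \<xi> $ k * (1 / sin (\<alpha> $ k))) = x \<bullet> coord_scale (csc_scale \<alpha> lam) \<xi>" for x
    by (simp add: inner_vec_def coord_scale_vec csc_scale_def sum_distrib_left mult_ac)
  have "h x * mfrft_kernel \<alpha> lam x \<xi>
      = ?c * (chirp \<alpha> (lam\<^sup>2) x * h x * cis (- (x \<bullet> coord_scale (csc_scale \<alpha> lam) \<xi>)))" for x
    unfolding mfrft_kernel_def inner by (simp add: cis_conv_exp mult_ac)
  then show ?thesis
    unfolding mfrft_integral_def fourier_def by (simp only: integral_mult_right_zero)
qed

text \<open>Multiplication by the chirp, the \<open>L\<^sup>2\<close> Fourier transform, and the dilation by \<open>csc_scale \<alpha> lam\<close> are all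
  continuous on \<open>L\<^sup>2\<close>, so the formula for integrable functions survives the passage to the limit.\<close>

lemma is_mfrft_fourier:
  fixes \<alpha> :: "real ^ 'n"
  assumes d: "coord_prod (csc_scale \<alpha> lam) \<noteq> 0" and \<psi>: "\<psi> \<in> L2_space"
    and \<Psi>: "is_L2_fourier (\<lambda>x. chirp \<alpha> (lam\<^sup>2) x * \<psi> x) \<Psi>"
  shows "is_mfrft \<alpha> lam \<psi> (\<lambda>\<xi>. cprod \<alpha> / complex_of_real (sqrt (2 * pi) ^ CARD('n))
    * chirp \<alpha> (lam\<^sup>2) \<xi> * \<Psi> (coord_scale (csc_scale \<alpha> lam) \<xi>))"
proof -
  let ?d = "csc_scale \<alpha> lam"
  let ?m = "\<lambda>\<xi>. cprod \<alpha> / complex_of_real (sqrt (2 * pi) ^ CARD('n)) * chirp \<alpha> (lam\<^sup>2) \<xi>"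
  have m: "?m \<in> borel_measurable lebesgue"
    by (intro borel_measurable_times borel_measurable_const chirp_measurable)
  have m_le: "cmod (?m \<xi>) \<le> cmod (cprod \<alpha> / complex_of_real (sqrt (2 * pi) ^ CARD('n)))" for \<xi>
    by (simp add: norm_mult norm_divide)
  have ch: "cmod (chirp \<alpha> (lam\<^sup>2) x) \<le> 1" for x by simp
  have \<Psi>2: "\<Psi> \<in> L2_space" using \<Psi> by (simp add: is_L2_fourier_def)
  have sc: "(\<lambda>x. u (coord_scale ?d x)) \<in> L2_space" if "u \<in> L2_space" for u :: "real ^ 'n \<Rightarrow> complex"
    using L2_space_affine[OF d that, of 0] by simp
  show ?thesis
    unfolding is_mfrft_def
  proof (intro conjI allI impI L2_space_mult[OF m m_le] sc \<Psi>2)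
    fix h assume "\<forall>n. h n \<in> L1_space \<inter> L2_space" and h\<psi>: "L2_tendsto h \<psi>"
    then have h1: "integrable lebesgue (h n)" and h2: "h n \<in> L2_space" for n by (auto simp: L1_space_def)
    have ch1: "integrable lebesgue (\<lambda>x. chirp \<alpha> (lam\<^sup>2) x * h n x)" for n
    proof (rule Bochner_Integration.integrable_bound[OF h1])
      show "(\<lambda>x. chirp \<alpha> (lam\<^sup>2) x * h n x) \<in> borel_measurable lebesgue"
        by (intro borel_measurable_times chirp_measurable L2_spaceD(1) h2)
      show "AE x in lebesgue. norm (chirp \<alpha> (lam\<^sup>2) x * h n x) \<le> norm (h n x)" by (simp add: norm_mult)
    qed
    have ch12: "(\<lambda>x. chirp \<alpha> (lam\<^sup>2) x * h n x) \<in> L1_space \<inter> L2_space" for n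
      using ch1 L2_space_mult[OF chirp_measurable ch h2] by (simp add: L1_space_def)
    note Fh = Plancherel_L1_L2(1)[OF ch12]
    have "L2_tendsto (\<lambda>n x. chirp \<alpha> (lam\<^sup>2) x * h n x) (\<lambda>x. chirp \<alpha> (lam\<^sup>2) x * \<psi> x)"
      by (rule L2_tendsto_mult[OF chirp_measurable ch h2 \<psi> h\<psi>])
    then have "L2_tendsto (\<lambda>n. fourier (\<lambda>x. chirp \<alpha> (lam\<^sup>2) x * h n x)) \<Psi>"
      using \<Psi> ch12 by (simp add: is_L2_fourier_def)
    from L2_tendsto_affine[OF d Fh \<Psi>2 this, of 0]
    have "L2_tendsto (\<lambda>n \<xi>. fourier (\<lambda>x. chirp \<alpha> (lam\<^sup>2) x * h n x) (coord_scale ?d \<xi>)) (\<lambda>\<xi>. \<Psi> (coord_scale ?d \<xi>))"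
      by simp
    from L2_tendsto_mult[OF m m_le sc[OF Fh] sc[OF \<Psi>2] this]
    show "L2_tendsto (\<lambda>n. mfrft_integral \<alpha> lam (h n)) (\<lambda>\<xi>. ?m \<xi> * \<Psi> (coord_scale ?d \<xi>))"
      unfolding mfrft_integral_eq_fourier[abs_def] .
  qed
qed

lemma is_mfrft_AE_unique:
  assumes \<psi>: "\<psi> \<in> L2_space" and F: "is_mfrft \<alpha> lam \<psi> F" and G: "is_mfrft \<alpha> lam \<psi> G"
    and mf: "\<And>h. h \<in> L1_space \<inter> L2_space \<Longrightarrow> mfrft_integral \<alpha> lam h \<in> L2_space"
  shows "AE x in lebesgue. F x = G x"
proof -
  obtain h where h: "\<And>n::nat. h n \<in> L1_space \<inter> L2_space" and "L2_tendsto h \<psi>"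
    using L2_dense_L1[OF \<psi>] by blast
  with F G show ?thesis
    by (intro L2_tendsto_unique[of "\<lambda>n. mfrft_integral \<alpha> lam (h n)"] mf) (auto simp: is_mfrft_def)
qed

lemma mfrft_integral_L2:
  fixes \<alpha> :: "real ^ 'n"
  assumes d: "coord_prod (csc_scale \<alpha> lam) \<noteq> 0" and h: "h \<in> L1_space \<inter> L2_space"
  shows "mfrft_integral \<alpha> lam h \<in> L2_space"
proof -
  let ?m = "\<lambda>\<xi>. cprod \<alpha> / complex_of_real (sqrt (2 * pi) ^ CARD('n)) * chirp \<alpha> (lam\<^sup>2) \<xi>"
  have h1: "integrable lebesgue h" and h2: "h \<in> L2_space" using h by (auto simp: L1_space_def)
  have ch: "cmod (chirp \<alpha> (lam\<^sup>2) x) \<le> 1" for x by simp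
  have "integrable lebesgue (\<lambda>x. chirp \<alpha> (lam\<^sup>2) x * h x)"
  proof (rule Bochner_Integration.integrable_bound[OF h1])
    show "(\<lambda>x. chirp \<alpha> (lam\<^sup>2) x * h x) \<in> borel_measurable lebesgue"
      by (intro borel_measurable_times chirp_measurable L2_spaceD(1) h2)
    show "AE x in lebesgue. norm (chirp \<alpha> (lam\<^sup>2) x * h x) \<le> norm (h x)" by (simp add: norm_mult)
  qed
  then have "(\<lambda>x. chirp \<alpha> (lam\<^sup>2) x * h x) \<in> L1_space \<inter> L2_space"
    using L2_space_mult[OF chirp_measurable ch h2] by (simp add: L1_space_def)
  from L2_space_affine[OF d Plancherel_L1_L2(1)[OF this], of 0]
  have "(\<lambda>\<xi>. fourier (\<lambda>x. chirp \<alpha> (lam\<^sup>2) x * h x) (coord_scale (csc_scale \<alpha> lam) \<xi>)) \<in> L2_space" by simp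
  then show ?thesis
    unfolding mfrft_integral_eq_fourier[abs_def]
  proof (rule L2_space_mult[rotated 2])
    show "?m \<in> borel_measurable lebesgue"
      by (intro borel_measurable_times borel_measurable_const chirp_measurable)
    show "cmod (?m \<xi>) \<le> cmod (cprod \<alpha> / complex_of_real (sqrt (2 * pi) ^ CARD('n)))" for \<xi>
      by (simp add: norm_mult norm_divide)
  qed
qed

text \<open>Existence by \<open>is_mfrft_fourier\<close> makes \<^const>\<open>mfrft\<close> a genuine transform, and uniqueness identifies it
  almost everywhere with the explicit one.\<close>

lemma mfrft_AE:
  fixes \<alpha> :: "real ^ 'n"
  assumes d: "coord_prod (csc_scale \<alpha> lam) \<noteq> 0" and \<psi>: "\<psi> \<in> L2_space"
    and \<Psi>: "is_L2_fourier (\<lambda>x. chirp \<alpha> (lam\<^sup>2) x * \<psi> x) \<Psi>"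
  shows "mfrft \<alpha> lam \<psi> \<in> borel_measurable lebesgue"
    and "AE \<xi> in lebesgue. (cmod (mfrft \<alpha> lam \<psi> \<xi>))\<^sup>2
      = (cmod (cprod \<alpha>))\<^sup>2 / (2 * pi) ^ CARD('n) * (cmod (\<Psi> (coord_scale (csc_scale \<alpha> lam) \<xi>)))\<^sup>2"
proof -
  note F = is_mfrft_fourier[OF assms]
  have M: "is_mfrft \<alpha> lam \<psi> (mfrft \<alpha> lam \<psi>)"
    unfolding mfrft_def by (rule someI[of "is_mfrft \<alpha> lam \<psi>", OF F])
  then show "mfrft \<alpha> lam \<psi> \<in> borel_measurable lebesgue"
    by (simp add: is_mfrft_def L2_space_def)
  have "AE \<xi> in lebesgue. mfrft \<alpha> lam \<psi> \<xi> = cprod \<alpha> / complex_of_real (sqrt (2 * pi) ^ CARD('n))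
      * chirp \<alpha> (lam\<^sup>2) \<xi> * \<Psi> (coord_scale (csc_scale \<alpha> lam) \<xi>)"
    by (rule is_mfrft_AE_unique[OF \<psi> M F]) (rule mfrft_integral_L2[OF d])
  note eq = this
  have sq: "(sqrt (2 * pi) ^ CARD('n))\<^sup>2 = (2 * pi) ^ CARD('n)"
  proof -
    have "(sqrt (2 * pi) ^ CARD('n))\<^sup>2 = ((sqrt (2 * pi))\<^sup>2) ^ CARD('n)"
      by (simp only: power_mult[symmetric] mult.commute)
    then show ?thesis by simp
  qed
  show "AE \<xi> in lebesgue. (cmod (mfrft \<alpha> lam \<psi> \<xi>))\<^sup>2
      = (cmod (cprod \<alpha>))\<^sup>2 / (2 * pi) ^ CARD('n) * (cmod (\<Psi> (coord_scale (csc_scale \<alpha> lam) \<xi>)))\<^sup>2"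
    using eq by eventually_elim (simp add: sq norm_mult norm_divide norm_power power_mult_distrib power_divide)
qed

text \<open>The chirp of the daughter wavelet in \<open>t\<close> is conjugate, so it passes to the signal as a chirp with the
  original sign.\<close>

lemma mfrwt_eq_cwt:
  fixes \<alpha> :: "real ^ 'n"
  shows "mfrwt \<alpha> lam \<psi> f a b = cprod \<alpha> * cnj (chirp \<alpha> (lam\<^sup>2) b) * complex_of_real (1 / sqrt (mod_prod a))
    * cwt (\<lambda>x. chirp \<alpha> (lam\<^sup>2) x * f x) (\<lambda>x. chirp \<alpha> (lam\<^sup>2) x * \<psi> x) a b"
proof -
  let ?c = "cprod \<alpha> * cnj (chirp \<alpha> (lam\<^sup>2) b) * complex_of_real (1 / sqrt (mod_prod a))"
  have v: "(\<chi> k. (t $ k - b $ k) / a $ k) = coord_scale (coord_inv a) (t - b)" for t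
    by (simp add: vec_eq_iff coord_scale_vec coord_inv_vec)
  have "f t * cnj (daughter_wavelet \<alpha> lam \<psi> a b t)
      = ?c * (chirp \<alpha> (lam\<^sup>2) t * f t * cnj (chirp \<alpha> (lam\<^sup>2) (coord_scale (coord_inv a) (t - b))
          * \<psi> (coord_scale (coord_inv a) (t - b))))" for t
    unfolding daughter_wavelet_def Let_def v cnj_chirp[of \<alpha> "lam\<^sup>2" t, symmetric]
    by (simp add: mult_ac)
  then show ?thesis
    unfolding mfrwt_def cwt_def L2_inner_def by (simp only: integral_mult_right_zero)
qed

text \<open>By \<open>mfrft_AE\<close> and dilation invariance, the integral in the admissibility condition is
  \<open>|cprod \<alpha>|\<^sup>2 / (2 * pi) ^ N\<close> times the constant \<open>\<kappa>\<close> of the ordinary wavelet \<open>chirp * \<psi>\<close>; the integrand of the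
  theorem is \<open>|cprod \<alpha>|\<^sup>2\<close> times the product of two normalized
  ordinary transforms. The factor \<open>(2 * pi) ^ N\<close> in \<^const>\<open>admissibility_const\<close> makes the two agree.\<close>

theorem theorem3p2:
  fixes \<alpha> :: "real ^ 'n" and lam :: real and \<psi> f g :: "real ^ 'n \<Rightarrow> complex"
  assumes "lam \<noteq> 0"
    and "\<And>k. \<alpha> $ k \<in> {-pi<..<pi} - {0}"
    and "admissible_wavelet \<alpha> lam \<psi>"
    and "f \<in> L2_space" and "g \<in> L2_space"
  shows "set_integrable lebesgue (R0N \<times> UNIV)
      (\<lambda>(a, b). mfrwt \<alpha> lam \<psi> f a b * cnj (mfrwt \<alpha> lam \<psi> g a b) / complex_of_real ((mod_prod a)\<^sup>2)) \<and>
    (LINT (a, b):R0N \<times> UNIV|lebesgue.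
        mfrwt \<alpha> lam \<psi> f a b * cnj (mfrwt \<alpha> lam \<psi> g a b) / complex_of_real ((mod_prod a)\<^sup>2)) =
      complex_of_real (admissibility_const \<alpha> lam \<psi>) * L2_inner f g"
proof -
  let ?ch = "chirp \<alpha> (lam\<^sup>2)"
  let ?f = "\<lambda>x. ?ch x * f x" and ?g = "\<lambda>x. ?ch x * g x" and ?\<phi> = "\<lambda>x. ?ch x * \<psi> x"
  let ?d = "csc_scale \<alpha> lam"
  let ?C = "(cmod (cprod \<alpha>))\<^sup>2"
  let ?P = "(2 * pi) ^ CARD('n) :: real"
  have sin_nz: "sin (\<alpha> $ k) \<noteq> 0" for k
  proof (cases "\<alpha> $ k > 0")
    case True
    then show ?thesis using assms(2)[of k] sin_gt_zero[of "\<alpha> $ k"] by auto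
  next
    case False
    then show ?thesis using assms(2)[of k] sin_gt_zero[of "- (\<alpha> $ k)"] by auto
  qed
  have d: "coord_prod ?d \<noteq> 0"
    using assms(1) sin_nz by (simp add: coord_prod_vec mod_prod_def csc_scale_def)
  have C: "?C > 0" by (simp add: cprod_nonzero)
  have \<psi>: "\<psi> \<in> L2_space" using assms(3) by (simp add: admissible_wavelet_def)
  have ch: "(\<lambda>x. ?ch x * u x) \<in> L2_space" if "u \<in> L2_space" for u
    using that by (intro L2_space_mult[OF chirp_measurable, of _ _ 1]) auto
  obtain \<Psi> where \<Psi>: "is_L2_fourier ?\<phi> \<Psi>" and \<Psi>m: "\<Psi> \<in> borel_measurable borel"
    using L2_fourier_exists_borel[OF ch[OF \<psi>]] by blast
  note \<Psi>L = measurable_lborel_imp_lebesgue[OF \<Psi>m]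
  note mf = mfrft_AE[OF d \<psi> \<Psi>]

  \<comment> \<open>Since division by 0 gives 0, \<open>A\<close> vanishes off \<^const>\<open>R0N\<close> and its integral over the whole space is the
    admissibility integral.\<close>
  have cpm: "(coord_prod :: real ^ 'n \<Rightarrow> real) \<in> borel_measurable lebesgue"
    by (rule measurable_lborel_imp_lebesgue[OF measurable_coord_prod])
  have ind: "indicator R0N u * (y / mod_prod u) = y / mod_prod u" for u :: "real ^ 'n" and y :: real
    by (auto simp: R0N_def indicator_def)
  define A where "A u = (cmod (mfrft \<alpha> lam \<psi> u))\<^sup>2 / mod_prod u" for u
  have A0: "A u \<ge> 0" for u by (simp add: A_def mod_prod_def)
  have Am: "A \<in> borel_measurable lebesgue"
    unfolding A_def coord_prod_vec[symmetric]
    using mf(1) cpm by measurable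
  have A_nn: "(\<integral>\<^sup>+u. ennreal (A u) \<partial>lebesgue)
      = ennreal (?C / ?P) * (\<integral>\<^sup>+u. ennreal ((cmod (\<Psi> u))\<^sup>2 / coord_prod u) \<partial>lebesgue)"
  proof -
    have "(\<integral>\<^sup>+u. ennreal (A u) \<partial>lebesgue)
        = (\<integral>\<^sup>+u. ennreal (?C / ?P) * ennreal ((cmod (\<Psi> (coord_scale ?d u)))\<^sup>2 / coord_prod u) \<partial>lebesgue)"
      using mf(2)
      by (intro nn_integral_cong_AE, eventually_elim)
         (simp add: A_def coord_prod_vec[symmetric] flip: ennreal_mult)
    also have "\<dots> = ennreal (?C / ?P) * (\<integral>\<^sup>+u. ennreal ((cmod (\<Psi> (coord_scale ?d u)))\<^sup>2 / coord_prod u) \<partial>lebesgue)"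
      unfolding nn_integral_completion
    proof (rule nn_integral_cmult)
      note [measurable] = \<Psi>m
      show "(\<lambda>u. ennreal ((cmod (\<Psi> (coord_scale ?d u)))\<^sup>2 / coord_prod u)) \<in> borel_measurable lborel"
        by measurable
    qed
    finally show ?thesis unfolding nn_integral_dilation_invariant[OF \<Psi>L d] .
  qed
  have "(\<integral>\<^sup>+u. ennreal (A u) \<partial>lebesgue) < \<infinity>"
  proof -
    have "(\<integral>\<^sup>+u. ennreal (A u) \<partial>lebesgue)
        = (\<integral>\<^sup>+ u \<in> R0N. ennreal ((cmod (mfrft \<alpha> lam \<psi> u))\<^sup>2 / mod_prod u) \<partial>lebesgue)"
      by (intro nn_integral_cong) (simp add: A_def R0N_def indicator_def)
    then show ?thesis using assms(3) by (simp add: admissible_wavelet_def)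
  qed
  then have "(\<integral>\<^sup>+u. ennreal ((cmod (\<Psi> u))\<^sup>2 / coord_prod u) \<partial>lebesgue) < \<infinity>"
    unfolding A_nn using C by (auto simp: ennreal_mult_less_top)
  then obtain \<kappa> where \<kappa>: "(\<integral>\<^sup>+u. ennreal ((cmod (\<Psi> u))\<^sup>2 / coord_prod u) \<partial>lebesgue) = ennreal \<kappa>" "\<kappa> \<ge> 0"
    by (cases "\<integral>\<^sup>+u. ennreal ((cmod (\<Psi> u))\<^sup>2 / coord_prod u) \<partial>lebesgue") auto
  have "(LINT u:R0N|lebesgue. (cmod (mfrft \<alpha> lam \<psi> u))\<^sup>2 / mod_prod u) = (LINT u|lebesgue. A u)"
    unfolding set_lebesgue_integral_def A_def by (simp only: real_scaleR_def ind)
  also have "\<dots> = enn2real (\<integral>\<^sup>+u. ennreal (A u) \<partial>lebesgue)"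
    using Am A0 by (intro integral_eq_nn_integral) auto
  also have "\<dots> = ?C / ?P * \<kappa>"
    unfolding A_nn \<kappa>(1) using \<kappa>(2) by (simp flip: ennreal_mult)
  finally have adm: "admissibility_const \<alpha> lam \<psi> = ?C * \<kappa>"
    by (simp add: admissibility_const_def)

  \<comment> \<open>The phases of the chirps in \<open>b\<close> cancel; at degenerate scales both sides vanish.\<close>
  let ?U = "cwt_density ?\<phi>"
  have integrand: "indicator (R0N \<times> UNIV) p *\<^sub>R (case p of (a, b) \<Rightarrow>
      mfrwt \<alpha> lam \<psi> f a b * cnj (mfrwt \<alpha> lam \<psi> g a b) / complex_of_real ((mod_prod a)\<^sup>2))
    = complex_of_real ?C * (?U ?f p * cnj (?U ?g p))" for p
  proof (cases p)
    case (Pair a b)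
    show ?thesis
    proof (cases "mod_prod a = 0")
      case False
      let ?p = "mod_prod a"
      have p: "?p > 0" using False by (simp add: mod_prod_def)
      have s1: "complex_of_real (1 / sqrt ?p) * complex_of_real (1 / sqrt ?p) = complex_of_real (1 / ?p)"
        using p by (simp flip: of_real_mult)
      have s3: "complex_of_real (sqrt (?p ^ 3)) * complex_of_real (sqrt (?p ^ 3)) = complex_of_real (?p ^ 3)"
        using p by (simp flip: of_real_mult)
      let ?u = "cwt ?f ?\<phi> a b" and ?v = "cwt ?g ?\<phi> a b"
      have "mfrwt \<alpha> lam \<psi> f a b * cnj (mfrwt \<alpha> lam \<psi> g a b)
          = (cprod \<alpha> * cnj (cprod \<alpha>)) * (?ch b * cnj (?ch b))
            * (complex_of_real (1 / sqrt ?p) * complex_of_real (1 / sqrt ?p)) * (?u * cnj ?v)"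
        unfolding mfrwt_eq_cwt by (simp add: mult_ac)
      also have "\<dots> = complex_of_real ?C * complex_of_real (1 / ?p) * (?u * cnj ?v)"
        unfolding s1 chirp_mult_cnj complex_norm_square[symmetric] by simp
      finally have w: "mfrwt \<alpha> lam \<psi> f a b * cnj (mfrwt \<alpha> lam \<psi> g a b)
          = complex_of_real ?C * complex_of_real (1 / ?p) * (?u * cnj ?v)" .
      have "?U ?f p * cnj (?U ?g p) = (?u * cnj ?v) / (complex_of_real (sqrt (?p ^ 3)) * complex_of_real (sqrt (?p ^ 3)))"
        by (simp add: Pair cwt_density_def coord_prod_vec)
      then have U: "?U ?f p * cnj (?U ?g p) = (?u * cnj ?v) / complex_of_real (?p ^ 3)" unfolding s3 .
      show ?thesis
        unfolding U using False
        by (simp add: Pair w R0N_def power2_eq_square power3_eq_cube)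
    qed (simp add: Pair R0N_def cwt_density_def coord_prod_vec)
  qed
  note iso = cwt_density_isometry(1)[OF ch ch[OF \<psi>] \<Psi> \<Psi>m \<kappa>]
  have int: "integrable lebesgue (\<lambda>p. ?U ?f p * cnj (?U ?g p))"
    by (rule L2_mult_integrable[OF iso[OF assms(4)] iso[OF assms(5)]])
  have fg: "L2_inner ?f ?g = L2_inner f g"
  proof -
    have "?f x * cnj (?g x) = f x * cnj (g x)" for x
    proof -
      have "?f x * cnj (?g x) = (?ch x * cnj (?ch x)) * (f x * cnj (g x))" by (simp add: mult_ac)
      then show ?thesis by simp
    qed
    then show ?thesis by (simp only: L2_inner_def)
  qed
  have "(LINT p|lebesgue. ?U ?f p * cnj (?U ?g p)) = complex_of_real \<kappa> * L2_inner f g"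
    using cwt_density_Parseval[OF ch[OF assms(4)] ch[OF assms(5)] ch[OF \<psi>] \<Psi> \<Psi>m \<kappa>]
    unfolding fg by (simp add: L2_inner_def)
  then show ?thesis
    unfolding set_integrable_def set_lebesgue_integral_def integrand adm
    using integrable_mult_right[OF int] by simp
qed

end
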